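(* Let $(\Omega,\mathcal{F},\mathbb{P})$ be a probability space and let $\{f_n\}_{n\in\mathbb{N}}$ be a sequence of nonnegative, real-valued, measurable functions on $\Omega$. Then there exist a measurable function $f_*:\Omega\to[0,\infty]$ and a subsequence $\{f_{n_k}\}_{k\in\mathbb{N}}$ of $\{f_n\}_{n\in\mathbb{N}}$ that converges hereditarily in Cesàro mean to $f_*$, $\mathbb{P}$-a.e.; that is, for every subsequence $\{f_{n_{k_j}}\}_{j\in\mathbb{N}}$ of $\{f_{n_k}\}_{k\in\mathbb{N}}$, $$\lim_{J\to\infty}\frac1J\sum_{j=1}^J f_{n_{k_j}}=f_*,\qquad \mathbb{P}\text{-a.e.}$$
   Context: A sequence $\{g_n\}_{n\in\mathbb{N}}$ of real-valued measurable functions on $(\Omega,\mathcal{F},\mathbb{P})$ converges hereditarily in Cesàro mean to a measurable $g_*:\Omega\to\mathbb{R}\cup\{\pm\infty\}$, $\mathbb{P}$-a.e., if for every subsequence $\{g_{n_k}\}_{k\in\mathbb{N}}$ (including the sequence itself) one has $\lim_{K\to\infty}\frac1K\sum_{k=1}^K g_{n_k}=g_*$, $\mathbb{P}$-a.e. (the exceptional null set may depend on the subsequence). *)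

theory Defs
  imports "HOL-Probability.Probability"
begin

text \<open>
  Subsequences are given by strictly increasing index maps; the identity map is one of them, so the
  sequence itself is included. The quantifier over index maps stands outside AE, so
  the exceptional null set may depend on the subsequence. Sequences are indexed from 0, so the
  K-th mean averages the terms with indices 0, ..., K - 1; the value for K = 0 is irrelevant for
  the limit. The limit is taken in the extended reals, where infinite values are proper limits.
\<close>

definition hereditarily_cesaro_convergent ::
    "'a measure \<Rightarrow> (nat \<Rightarrow> 'a \<Rightarrow> real) \<Rightarrow> ('a \<Rightarrow> ereal) \<Rightarrow> bool" where
  "hereditarily_cesaro_convergent M g g_lim \<longleftrightarrow>
     (\<forall>r :: nat \<Rightarrow> nat. strict_mono r \<longrightarrow>
        (AE \<omega> in M. (\<lambda>K. ereal ((1 / real K) * (\<Sum>k<K. g (r k) \<omega>))) \<longlonglongrightarrow> g_lim \<omega>))"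

end

theory Submission
  imports Defs "HOL-Library.Diagonal_Subsequence"
begin

text \<open>
  This is the nonnegative form of Komlos' theorem, in which no integrability is assumed.

  Truncate: for each level b the functions \<open>min (f n) b\<close> are bounded, so along a subsequence they
  converge weakly to some \<open>h b\<close>, for all b at once (\<open>countable_weak_compactness\<close>). The limit is
  \<open>F = SUP b. h b\<close>. Thinning out the subsequence makes the centred truncations
  \<open>min (f n) b - h b\<close> almost orthogonal to each other, with errors so small that every further
  subsequence inherits them. For almost orthogonal terms the variance of a sum is about the sum of the
  variances, and the proof of the strong law of large numbers applies: Chebyshev's inequality
  along the indices \<open>\<alpha> ^ i\<close> and, since the functions are nonnegative, monotone interpolation between
  those indices, as in Etemadi's proof (\<open>truncated_cesaro_AE\<close>).

  Where F is infinite, truncation at a fixed level N shows that the lower limit of the means is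
  at least \<open>h N\<close>, for every N.

  Where F is finite, the k-th term is truncated at the level \<open>k + 1\<close>. The law of large numbers then
  needs the second moments of the truncated terms, divided by \<open>(k + 1)\<^sup>2\<close>, to be summable. All moments
  are taken with respect to the weight \<open>w = 1 / (1 + F)\<^sup>2\<close>, extended by 0 to the set where F is
  infinite; it makes the first moments of all the \<open>h b\<close> at most 1. The pointwise bound
  \<open>(\<Sum>b=1..B. (min x b)\<^sup>2 / b\<^sup>2) \<le> 3 * min x B\<close> turns this into a bound on the series
  (\<open>truncated_second_moments_sum_le\<close>). The same series shows that almost everywhere only finitely
  many terms are changed by the truncation, so the means of the original functions have the limit F.
\<close>

section \<open>Selecting subsequences\<close>

text \<open>
  Conditions on pairs of terms that hold once the later index is large enough compared with the
  earlier one can all be met by one subsequence that grows fast enough. The condition imposed on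
  the k-th selected term may depend on k; this is how errors get the size \<^term>\<open>(1/2) ^ k\<close>.
\<close>

lemma fast_subsequence:
  fixes Q :: "nat \<Rightarrow> nat \<Rightarrow> nat \<Rightarrow> bool" and R :: "nat \<Rightarrow> nat \<Rightarrow> bool"
  assumes Q: "\<And>k j. eventually (Q k j) sequentially"
    and R: "\<And>k. eventually (R k) sequentially"
  shows "\<exists>s. strict_mono s \<and> (\<forall>k. R k (s k)) \<and> (\<forall>k. \<forall>j<k. Q k (s j) (s k))"
proof -
  have "\<exists>s. \<forall>k. R k (s k) \<and> (s k < s (Suc k) \<and> (\<forall>j\<le>s k. Q (Suc k) j (s (Suc k))))"
  proof (rule dependent_nat_choice)
    show "\<exists>n. R 0 n"
      using R[of 0] by (auto simp: eventually_sequentially)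
  next
    fix m k
    \<comment> \<open>requiring this for every index up to the current one covers all the indices chosen before\<close>
    have "eventually (\<lambda>n. \<forall>j\<in>{..m}. Q (Suc k) j n) sequentially"
      by (rule eventually_ball_finite) (use Q in auto)
    then have "eventually (\<lambda>n. R (Suc k) n \<and> m < n \<and> (\<forall>j\<in>{..m}. Q (Suc k) j n)) sequentially"
      using R[of "Suc k"] eventually_gt_at_top[of m] by eventually_elim auto
    then show "\<exists>n. R (Suc k) n \<and> (m < n \<and> (\<forall>j\<le>m. Q (Suc k) j n))"
      by (auto simp: eventually_sequentially)
  qed
  then obtain s where s: "\<And>k. R k (s k)" "\<And>k. s k < s (Suc k)"
      "\<And>k j. j \<le> s k \<Longrightarrow> Q (Suc k) j (s (Suc k))"
    by blast
  have mono: "strict_mono s"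
    by (simp add: s(2) strict_mono_Suc_iff)
  have "Q k (s j) (s k)" if less: "j < k" for j k
  proof -
    obtain k' where k: "k = Suc k'" using less by (cases k) auto
    have "s j \<le> s k'" using mono less k by (simp add: strict_mono_less_eq)
    then show ?thesis using s(3) k by blast
  qed
  then show ?thesis using s mono by blast
qed

lemma diagonal_limits:
  fixes x :: "nat \<Rightarrow> nat \<Rightarrow> real"
  assumes bnd: "\<And>j n. \<bar>x j n\<bar> \<le> C"
  shows "\<exists>s a. strict_mono s \<and> (\<forall>j. (\<lambda>n. x j (s n)) \<longlonglongrightarrow> a j)"
proof -
  interpret subseqs "\<lambda>j s. convergent (\<lambda>n. x j (s n))"
  proof
    fix j :: nat and s :: "nat \<Rightarrow> nat"
    have "bounded (range (\<lambda>n. x j (s n)))"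
      unfolding bounded_iff using bnd by auto
    then obtain l r where "strict_mono r" "((\<lambda>n. x j (s n)) \<circ> r) \<longlonglongrightarrow> l"
      using bounded_imp_convergent_subsequence by blast
    then show "\<exists>r'. strict_mono r' \<and> convergent (\<lambda>n. x j ((s \<circ> r') n))"
      by (auto simp: o_def convergent_def)
  qed
  have "convergent (\<lambda>n. x j (diagseq n))" for j
  proof -
    have "convergent (\<lambda>n. x j ((diagseq \<circ> (+) (Suc j)) n))"
    proof (rule diagseq_holds)
      fix r s :: "nat \<Rightarrow> nat" and n
      assume "strict_mono r" "convergent (\<lambda>i. x n (s i))"
      then show "convergent (\<lambda>i. x n ((s \<circ> r) i))"
        using convergent_subseq_convergent[of "\<lambda>i. x n (s i)" r] by (simp add: o_def)
    qed
    then have "convergent (\<lambda>n. x j (diagseq (n + Suc j)))"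
      by (simp add: o_def add.commute)
    then show ?thesis
      using convergent_ignore_initial_segment[of "\<lambda>n. x j (diagseq n)" "Suc j"] by simp
  qed
  then have "\<forall>j. (\<lambda>n. x j (diagseq n)) \<longlonglongrightarrow> lim (\<lambda>n. x j (diagseq n))"
    by (simp add: convergent_LIMSEQ_iff)
  with subseq_diagseq show ?thesis
    by (intro exI[of _ diagseq] exI[of _ "\<lambda>j. lim (\<lambda>n. x j (diagseq n))"]) simp
qed

text \<open>
  For a Gram matrix this says that along a subsequence all the inner products of different terms are
  close to a single number \<^term>\<open>\<alpha>\<close>, with summable errors. Row limits \<^term>\<open>A i\<close> exist by the
  diagonal argument, a convergent subsequence of them gives \<^term>\<open>\<alpha>\<close>, and thinning out makes both
  convergences fast.
\<close>

lemma iterated_limit_subsequence: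
  fixes G :: "nat \<Rightarrow> nat \<Rightarrow> real"
  assumes bnd: "\<And>i j. \<bar>G i j\<bar> \<le> C"
  shows "\<exists>s A \<alpha>. strict_mono s \<and> (\<forall>i. (\<lambda>n. G (s i) (s n)) \<longlonglongrightarrow> A i) \<and> A \<longlonglongrightarrow> \<alpha>
    \<and> (\<forall>i j. i < j \<longrightarrow> \<bar>G (s i) (s j) - A i\<bar> \<le> (1/2) ^ j) \<and> (\<forall>i. \<bar>A i - \<alpha>\<bar> \<le> (1/2) ^ i)"
proof -
  obtain p a where p: "strict_mono p" "\<And>i. (\<lambda>n. G i (p n)) \<longlonglongrightarrow> a i"
    using diagonal_limits[of G C] bnd by blast
  have "\<bar>a i\<bar> \<le> C" for i
    by (rule LIMSEQ_le_const2[OF tendsto_rabs[OF p(2)]]) (use bnd in auto)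
  then have "bounded (range (\<lambda>n. a (p n)))"
    unfolding bounded_iff by auto
  then obtain \<alpha> q where q: "strict_mono q" "((\<lambda>n. a (p n)) \<circ> q) \<longlonglongrightarrow> \<alpha>"
    using bounded_imp_convergent_subsequence by blast
  define r where "r = p \<circ> q"
  have r: "strict_mono r" "\<And>i. (\<lambda>n. G i (r n)) \<longlonglongrightarrow> a i" "(\<lambda>n. a (r n)) \<longlonglongrightarrow> \<alpha>"
    using p q LIMSEQ_subseq_LIMSEQ[OF p(2) q(1)] by (auto simp: r_def o_def strict_mono_def)
  have "\<exists>t. strict_mono t \<and> (\<forall>k. \<bar>a (r (t k)) - \<alpha>\<bar> \<le> (1/2)^k) \<and>
    (\<forall>k. \<forall>j<k. \<bar>G (r (t j)) (r (t k)) - a (r (t j))\<bar> \<le> (1/2)^k)"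
  proof (rule fast_subsequence)
    show "\<forall>\<^sub>F n in sequentially. \<bar>G (r j) (r n) - a (r j)\<bar> \<le> (1/2)^k" for k j :: nat
      using tendstoD[OF r(2)[of "r j"], of "(1/2)^k"]
      by (auto simp: dist_real_def elim: eventually_mono)
    show "\<forall>\<^sub>F n in sequentially. \<bar>a (r n) - \<alpha>\<bar> \<le> (1/2)^k" for k :: nat
      using tendstoD[OF r(3), of "(1/2)^k"]
      by (auto simp: dist_real_def elim: eventually_mono)
  qed
  then obtain t where t: "strict_mono t" "\<And>k. \<bar>a (r (t k)) - \<alpha>\<bar> \<le> (1/2)^k"
      "\<And>j k. j < k \<Longrightarrow> \<bar>G (r (t j)) (r (t k)) - a (r (t j))\<bar> \<le> (1/2)^k"
    by blast
  have "(\<lambda>n. G (r (t i)) (r (t n))) \<longlonglongrightarrow> a (r (t i))" for i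
    using LIMSEQ_subseq_LIMSEQ[OF r(2) t(1)] by (simp add: o_def)
  moreover have "(\<lambda>i. a (r (t i))) \<longlonglongrightarrow> \<alpha>"
    using LIMSEQ_subseq_LIMSEQ[OF r(3) t(1)] by (simp add: o_def)
  moreover have "strict_mono (r \<circ> t)"
    using r(1) t(1) by (rule strict_mono_o)
  ultimately show ?thesis
    using t(2,3) unfolding o_def
    by (intro exI[of _ "\<lambda>i. r (t i)"] exI[of _ "\<lambda>i. a (r (t i))"] exI[of _ \<alpha>] conjI allI impI)
qed

section \<open>Cesaro means and Gram matrices of real numbers\<close>

lemma cesaro_mean_tendsto:
  fixes x :: "nat \<Rightarrow> real"
  assumes "x \<longlonglongrightarrow> c"
  shows "(\<lambda>K. (\<Sum>k<K. x k) / real K) \<longlonglongrightarrow> c"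
proof (rule LIMSEQ_I)
  fix \<epsilon> :: real assume "0 < \<epsilon>"
  then obtain N where N: "\<And>n. N \<le> n \<Longrightarrow> \<bar>x n - c\<bar> < \<epsilon>/2"
    using LIMSEQ_D[OF assms, of "\<epsilon>/2"] by auto
  define D where "D = (\<Sum>k<N. \<bar>x k - c\<bar>)"
  obtain N' where N': "\<And>n. n \<ge> N' \<Longrightarrow> \<bar>D / real n\<bar> < \<epsilon>/2"
    using LIMSEQ_D[OF lim_const_over_n[of D], of "\<epsilon>/2"] \<open>0 < \<epsilon>\<close> by auto
  show "\<exists>no. \<forall>n\<ge>no. norm ((\<Sum>k<n. x k) / real n - c) < \<epsilon>"
  proof (intro exI allI impI)
    fix n assume n: "n \<ge> max 1 (max N N')"
    have "\<bar>\<Sum>k<n. x k - c\<bar> \<le> (\<Sum>k<n. \<bar>x k - c\<bar>)" by (rule sum_abs)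
    also have "(\<Sum>k<n. \<bar>x k - c\<bar>) = D + (\<Sum>k\<in>{N..<n}. \<bar>x k - c\<bar>)"
      using n unfolding D_def lessThan_atLeast0 by (subst sum.atLeastLessThan_concat) auto
    also have "(\<Sum>k\<in>{N..<n}. \<bar>x k - c\<bar>) \<le> (\<Sum>k\<in>{N..<n}. \<epsilon>/2)"
      by (intro sum_mono less_imp_le[OF N]) auto
    also have "\<dots> \<le> real n * (\<epsilon>/2)"
      using \<open>0 < \<epsilon>\<close> by (simp add: mult_right_mono)
    finally have "\<bar>\<Sum>k<n. x k - c\<bar> \<le> D + real n * (\<epsilon>/2)" by simp
    then have "\<bar>\<Sum>k<n. x k - c\<bar> / real n \<le> (D + real n * (\<epsilon>/2)) / real n"
      by (rule divide_right_mono) simp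
    also have "\<dots> = D / real n + \<epsilon>/2"
      using n by (simp add: field_simps)
    also have "\<dots> < \<epsilon>" using N'[of n] n abs_ge_self[of "D / real n"] by linarith
    finally have "\<bar>\<Sum>k<n. x k - c\<bar> / real n < \<epsilon>" .
    moreover have "(\<Sum>k<n. x k) / real n - c = (\<Sum>k<n. x k - c) / real n"
      using n by (simp add: sum_subtractf field_simps)
    ultimately show "norm ((\<Sum>k<n. x k) / real n - c) < \<epsilon>"
      by (simp add: abs_divide)
  qed
qed

lemma sum_half_powers_le: "finite F \<Longrightarrow> (\<Sum>i\<in>F. (1/2 :: real) ^ i) \<le> 2"
  using sum_le_suminf[of "\<lambda>i. (1/2 :: real) ^ i" F] by (simp add: suminf_geometric)

text \<open>
  Off-diagonal errors of this size contribute to the double sum only linearly in the number of terms,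
  although there are quadratically many of them. Hence nearly orthogonal functions obey the same
  variance bound as orthogonal ones, up to a constant for each term.
\<close>

lemma gram_sum_le:
  fixes G :: "nat \<Rightarrow> nat \<Rightarrow> real"
  assumes F: "finite F" "finite H" and E: "0 \<le> E"
    and diag: "\<And>i. i \<in> F \<Longrightarrow> i \<in> H \<Longrightarrow> G i i \<le> a i" and a: "\<And>i. 0 \<le> a i"
    and off: "\<And>i j. i \<in> F \<Longrightarrow> j \<in> H \<Longrightarrow> i \<noteq> j \<Longrightarrow> G i j \<le> E * ((1/2) ^ i + (1/2) ^ j)"
  shows "(\<Sum>i\<in>F. \<Sum>j\<in>H. G i j) \<le> (\<Sum>i\<in>F. a i) + 2 * E * (card F + card H)"
proof -
  have "(\<Sum>i\<in>F. \<Sum>j\<in>H. G i j)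
      \<le> (\<Sum>i\<in>F. \<Sum>j\<in>H. (if i = j then a i else 0) + (E * (1/2) ^ i + E * (1/2) ^ j))"
  proof (intro sum_mono)
    fix i j assume "i \<in> F" "j \<in> H"
    then show "G i j \<le> (if i = j then a i else 0) + (E * (1/2) ^ i + E * (1/2) ^ j)"
      using diag[of i] off[of i j] E
      by (cases "i = j") (auto intro: add_increasing2 simp: distrib_left)
  qed
  also have "\<dots> = (\<Sum>i\<in>F. if i \<in> H then a i else 0)
      + (E * (\<Sum>i\<in>F. (1/2) ^ i) * card H + E * (\<Sum>j\<in>H. (1/2) ^ j) * card F)"
    using F by (simp only: sum.distrib sum_distrib_left[symmetric] sum_distrib_right[symmetric]
        sum_constant sum.delta) (simp add: sum_distrib_left[symmetric] mult.commute mult.left_commute)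
  also have "\<dots> \<le> (\<Sum>i\<in>F. a i) + (E * 2 * card H + E * 2 * card F)"
    using sum_half_powers_le[OF F(1)] sum_half_powers_le[OF F(2)] E a
    by (intro add_mono mult_right_mono mult_left_mono sum_mono) auto
  also have "\<dots> = (\<Sum>i\<in>F. a i) + 2 * E * (card F + card H)" by (simp add: distrib_left)
  finally show ?thesis .
qed

lemma sum_square_eq: "(\<Sum>i\<in>F. v i :: real)\<^sup>2 = (\<Sum>i\<in>F. \<Sum>j\<in>F. v i * v j)"
  by (simp add: power2_eq_square sum_product)

lemma abs_mult_le_bounds:
  fixes a b :: real
  assumes "\<bar>a\<bar> \<le> A" "\<bar>b\<bar> \<le> B" shows "\<bar>a * b\<bar> \<le> A * B"
  using assms unfolding abs_mult by (intro mult_mono) auto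

section \<open>Weak compactness of bounded sequences\<close>

text \<open>
  Weak convergence tested against bounded measurable functions. For uniformly bounded sequences on a
  probability space, the only ones considered here, this is weak convergence in L2.
\<close>

definition weakly_tendsto :: "'a measure \<Rightarrow> (nat \<Rightarrow> 'a \<Rightarrow> real) \<Rightarrow> ('a \<Rightarrow> real) \<Rightarrow> bool" where
  "weakly_tendsto M u h \<longleftrightarrow> (\<forall>y B. y \<in> borel_measurable M \<longrightarrow> (\<forall>x. \<bar>y x\<bar> \<le> B) \<longrightarrow>
     (\<lambda>n. \<integral>x. u n x * y x \<partial>M) \<longlonglongrightarrow> (\<integral>x. h x * y x \<partial>M))"

lemma weakly_tendstoD:
  assumes "weakly_tendsto M u h" "y \<in> borel_measurable M" "\<And>x. \<bar>y x\<bar> \<le> B"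
  shows "(\<lambda>n. \<integral>x. u n x * y x \<partial>M) \<longlonglongrightarrow> (\<integral>x. h x * y x \<partial>M)"
  using assms unfolding weakly_tendsto_def by blast

lemma weakly_tendsto_subseq:
  assumes "weakly_tendsto M u h" "strict_mono s"
  shows "weakly_tendsto M (\<lambda>n. u (s n)) h"
  unfolding weakly_tendsto_def
proof (intro allI impI)
  fix y B assume "y \<in> borel_measurable M" "\<forall>x. \<bar>y x\<bar> \<le> (B::real)"
  then have "(\<lambda>n. \<integral>x. u n x * y x \<partial>M) \<longlonglongrightarrow> (\<integral>x. h x * y x \<partial>M)"
    using weakly_tendstoD[OF assms(1)] by blast
  from LIMSEQ_subseq_LIMSEQ[OF this assms(2)]
  show "(\<lambda>n. \<integral>x. u (s n) x * y x \<partial>M) \<longlonglongrightarrow> (\<integral>x. h x * y x \<partial>M)"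
    by (simp add: o_def)
qed

context prob_space
begin

lemma integrable_bounded:
  fixes g :: "'a \<Rightarrow> real"
  assumes "g \<in> borel_measurable M" "\<And>x. \<bar>g x\<bar> \<le> B"
  shows "integrable M g"
  using assms by (intro integrable_const_bound[of _ B]) auto

lemma abs_integral_le_bound:
  fixes g :: "'a \<Rightarrow> real"
  assumes "g \<in> borel_measurable M" "\<And>x. \<bar>g x\<bar> \<le> B"
  shows "\<bar>\<integral>x. g x \<partial>M\<bar> \<le> B"
proof -
  have "\<bar>\<integral>x. g x \<partial>M\<bar> \<le> (\<integral>x. \<bar>g x\<bar> \<partial>M)" by (rule integral_abs_bound)
  also have "\<dots> \<le> (\<integral>x. B \<partial>M)"
    using assms order_trans[OF abs_ge_zero assms(2)]
    by (intro integral_mono integrable_bounded[of _ B]) auto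
  finally show ?thesis by (simp add: prob_space)
qed

lemma integral_square_sum:
  fixes v :: "nat \<Rightarrow> 'a \<Rightarrow> real"
  assumes F: "finite F" and int: "\<And>i j. i \<in> F \<Longrightarrow> j \<in> F \<Longrightarrow> integrable M (\<lambda>x. w x * (v i x * v j x))"
  shows "(\<integral>x. w x * (\<Sum>i\<in>F. v i x)\<^sup>2 \<partial>M) = (\<Sum>i\<in>F. \<Sum>j\<in>F. \<integral>x. w x * (v i x * v j x) \<partial>M)"
proof -
  have "(\<integral>x. w x * (\<Sum>i\<in>F. v i x)\<^sup>2 \<partial>M) = (\<integral>x. (\<Sum>i\<in>F. \<Sum>j\<in>F. w x * (v i x * v j x)) \<partial>M)"
    by (simp add: sum_square_eq sum_distrib_left)
  also have "\<dots> = (\<Sum>i\<in>F. \<Sum>j\<in>F. \<integral>x. w x * (v i x * v j x) \<partial>M)"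
    using int by (simp add: Bochner_Integration.integral_sum)
  finally show ?thesis .
qed

text \<open>
  The inner product of two Cesaro means is close to \<^term>\<open>\<alpha>\<close> as soon as both lengths are large, so
  the squared L2 distance of the means, a combination of three such products with coefficients
  summing to zero, is small.
\<close>

lemma cesaro_means_L1_Cauchy:
  fixes u :: "nat \<Rightarrow> 'a \<Rightarrow> real"
  assumes [measurable]: "\<And>n. u n \<in> borel_measurable M"
    and C: "\<And>n x. \<bar>u n x\<bar> \<le> C"
    and gram: "\<And>i j. i \<noteq> j \<Longrightarrow> \<bar>(\<integral>x. u i x * u j x \<partial>M) - \<alpha>\<bar> \<le> (1/2) ^ i + (1/2) ^ j"
    and e: "0 < e"
  defines "T \<equiv> \<lambda>K x. (\<Sum>k<K. u k x) / real K"
  shows "\<exists>N. \<forall>K\<ge>N. \<forall>L\<ge>N. (\<integral>x. norm (T K x - T L x) \<partial>M) < e"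
proof -
  have C0: "0 \<le> C" using C[of 0 undefined] by linarith
  have [measurable]: "T K \<in> borel_measurable M" for K unfolding T_def by measurable
  have TC: "\<bar>T K x\<bar> \<le> C" for K x
  proof (cases "K = 0")
    case False
    have "\<bar>\<Sum>k<K. u k x\<bar> \<le> (\<Sum>k<K. C)" by (rule order_trans[OF sum_abs sum_mono]) (rule C)
    then show ?thesis using False by (simp add: T_def abs_divide field_simps)
  qed (simp add: T_def C0)
  have uu: "integrable M (\<lambda>x. u i x * u j x)" for i j
    by (rule integrable_bounded[OF _ abs_mult_le_bounds[OF C C]]) measurable
  have TT: "integrable M (\<lambda>x. T K x * T L x)" for K L
    by (rule integrable_bounded[OF _ abs_mult_le_bounds[OF TC TC]]) measurable
  define D where "D = C * C + \<bar>\<alpha>\<bar>"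
  define G where "G = (\<lambda>i j. (\<integral>x. u i x * u j x \<partial>M) - \<alpha>)"
  have diag: "\<bar>G i i\<bar> \<le> D" for i
  proof -
    have "\<bar>\<integral>x. u i x * u i x \<partial>M\<bar> \<le> C * C"
      by (rule abs_integral_le_bound[OF _ abs_mult_le_bounds[OF C C]]) measurable
    then show ?thesis unfolding G_def D_def by linarith
  qed
  have D0: "0 \<le> D" using diag[of 0] by linarith
  have TT_near: "\<bar>(\<integral>x. T K x * T L x \<partial>M) - \<alpha>\<bar> \<le> (D + 2) * (1 / K + 1 / L)"
    if "K > 0" "L > 0" for K L
  proof -
    have "(\<integral>x. T K x * T L x \<partial>M) = (\<integral>x. (\<Sum>i<K. \<Sum>j<L. u i x * u j x) / (real K * real L) \<partial>M)"
      unfolding T_def by (simp add: sum_product)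
    also have "\<dots> = (\<Sum>i<K. \<Sum>j<L. \<integral>x. u i x * u j x \<partial>M) / (real K * real L)"
      using uu by (simp add: Bochner_Integration.integral_sum)
    also have "\<dots> - \<alpha> = (\<Sum>i<K. \<Sum>j<L. G i j) / (real K * real L)"
      using that by (simp add: G_def sum_subtractf field_simps)
    finally have eq: "(\<integral>x. T K x * T L x \<partial>M) - \<alpha> = (\<Sum>i<K. \<Sum>j<L. G i j) / (real K * real L)" .
    have "\<bar>\<Sum>i<K. \<Sum>j<L. G i j\<bar> \<le> (\<Sum>i<K. \<Sum>j<L. \<bar>G i j\<bar>)"
      by (rule order_trans[OF sum_abs sum_mono[OF sum_abs]])
    also have "\<dots> \<le> (\<Sum>i<K. D) + 2 * 1 * real (card {..<K} + card {..<L})"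
      by (rule gram_sum_le) (use diag gram D0 in \<open>auto simp: G_def\<close>)
    also have "\<dots> \<le> (D + 2) * (real K + real L)"
      using D0 by (simp add: algebra_simps)
    finally have "\<bar>\<Sum>i<K. \<Sum>j<L. G i j\<bar> / (real K * real L) \<le> (D + 2) * (real K + real L) / (real K * real L)"
      by (rule divide_right_mono) simp
    also have "\<dots> = (D + 2) * (1 / K + 1 / L)"
      using that by (simp add: field_simps)
    finally show ?thesis unfolding eq by (simp add: abs_divide abs_mult)
  qed
  obtain N where N: "8 * (D + 2) / e\<^sup>2 < real N" using reals_Archimedean2 by blast
  moreover have "0 \<le> 8 * (D + 2) / e\<^sup>2" using D0 by simp
  ultimately have N0: "N > 0" by linarith
  have "(\<integral>x. norm (T K x - T L x) \<partial>M) < e" if KL: "K \<ge> N" "L \<ge> N" for K L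
  proof -
    have pos: "K > 0" "L > 0" using KL N0 by auto
    have inv: "1 / real K \<le> 1 / real N" "1 / real L \<le> 1 / real N"
      using KL N0 by (auto intro!: divide_left_mono)
    have near: "\<bar>(\<integral>x. T K' x * T L' x \<partial>M) - \<alpha>\<bar> \<le> (D + 2) * (2 / N)"
      if "K' \<in> {K, L}" "L' \<in> {K, L}" for K' L'
    proof -
      have "\<bar>(\<integral>x. T K' x * T L' x \<partial>M) - \<alpha>\<bar> \<le> (D + 2) * (1 / K' + 1 / L')"
        using that pos by (intro TT_near) auto
      also have "\<dots> \<le> (D + 2) * (1 / N + 1 / N)"
        using that inv D0 by (intro mult_left_mono add_mono) auto
      finally show ?thesis by simp
    qed
    have "(\<integral>x. (T K x - T L x)\<^sup>2 \<partial>M)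
        = (\<integral>x. T K x * T K x + T L x * T L x - 2 * (T K x * T L x) \<partial>M)"
      by (simp add: power2_eq_square algebra_simps)
    also have "\<dots> = (\<integral>x. T K x * T K x \<partial>M) + (\<integral>x. T L x * T L x \<partial>M) - 2 * (\<integral>x. T K x * T L x \<partial>M)"
      using TT by simp
    also have "\<dots> \<le> 4 * ((D + 2) * (2 / N))"
      using near[of K K] near[of K L] near[of L L] unfolding insert_iff abs_le_iff by linarith
    also have "\<dots> = 8 * (D + 2) / N" by simp
    also have "\<dots> < e\<^sup>2" using N N0 e by (simp add: field_simps)
    finally have sq: "(\<integral>x. (T K x - T L x)\<^sup>2 \<partial>M) < e\<^sup>2" .
    \<comment> \<open>the inequality \<open>2 * d * e \<le> d\<^sup>2 + e\<^sup>2\<close> replaces the comparison of the L1 and L2 norms\<close>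
    have "(\<integral>x. norm (T K x - T L x) \<partial>M) \<le> (\<integral>x. ((T K x - T L x)\<^sup>2 / e + e) / 2 \<partial>M)"
    proof (intro integral_mono integrable_norm)
      show "integrable M (\<lambda>x. T K x - T L x)"
        by (intro Bochner_Integration.integrable_diff integrable_bounded[of _ C] TC) auto
      have "integrable M (\<lambda>x. T K x * T K x + T L x * T L x - 2 * (T K x * T L x))"
        using TT by simp
      then have "integrable M (\<lambda>x. (T K x - T L x)\<^sup>2)"
        by (simp add: power2_eq_square algebra_simps)
      then show "integrable M (\<lambda>x. ((T K x - T L x)\<^sup>2 / e + e) / 2)" by simp
      fix x
      have "0 \<le> (\<bar>T K x - T L x\<bar> - e)\<^sup>2" by simp
      then show "norm (T K x - T L x) \<le> ((T K x - T L x)\<^sup>2 / e + e) / 2"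
        using e by (simp add: power2_diff field_simps) (simp add: power2_eq_square)
    qed
    also have "\<dots> = ((\<integral>x. (T K x - T L x)\<^sup>2 \<partial>M) / e + e) / 2"
    proof -
      have "integrable M (\<lambda>x. T K x * T K x + T L x * T L x - 2 * (T K x * T L x))"
        using TT by simp
      then have "integrable M (\<lambda>x. (T K x - T L x)\<^sup>2)"
        by (simp add: power2_eq_square algebra_simps)
      then show ?thesis by (simp add: prob_space)
    qed
    also have "\<dots> < e" using sq e by (simp add: field_simps power2_eq_square)
    finally show ?thesis .
  qed
  then show ?thesis by blast
qed

text \<open>
  A Bessel inequality in disguise: if the integral of \<^term>\<open>v n x * y x\<close> is at least \<open>e\<close> for m
  different indices, then pairing \<open>y\<close> with the sum of these \<^term>\<open>v n\<close> gives at least \<open>m * e\<close>, while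
  that sum has L2 norm of order \<open>sqrt m\<close> only. This bounds m.
\<close>

lemma nearly_orthogonal_weakly_null:
  fixes v :: "nat \<Rightarrow> 'a \<Rightarrow> real"
  assumes [measurable]: "\<And>n. v n \<in> borel_measurable M" "y \<in> borel_measurable M"
    and C: "\<And>n x. \<bar>v n x\<bar> \<le> C" and y: "\<And>x. \<bar>y x\<bar> \<le> B"
    and E: "0 \<le> E"
    and gram: "\<And>i j. i \<noteq> j \<Longrightarrow> (\<integral>x. v i x * v j x \<partial>M) \<le> E * ((1/2) ^ i + (1/2) ^ j)"
  shows "(\<lambda>n. \<integral>x. v n x * y x \<partial>M) \<longlonglongrightarrow> 0"
proof -
  have vv: "integrable M (\<lambda>x. v i x * v j x)" for i j
    by (rule integrable_bounded[OF _ abs_mult_le_bounds[OF C C]]) measurable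
  have key: "eventually (\<lambda>n. (\<integral>x. v n x * z x \<partial>M) < e) sequentially"
    if [measurable]: "z \<in> borel_measurable M" and z: "\<And>x. \<bar>z x\<bar> \<le> B" and e: "0 < e" for z e
  proof (rule ccontr)
    let ?S = "{n. e \<le> (\<integral>x. v n x * z x \<partial>M)}"
    assume "\<not> ?thesis"
    then have inf: "infinite ?S"
      unfolding eventually_sequentially infinite_nat_iff_unbounded_le by (auto simp: not_less)
    define A where "A = C * C + 4 * E"
    have "C * C \<ge> 0" by simp
    then have A0: "A \<ge> 0" using E by (simp add: A_def)
    have vz: "integrable M (\<lambda>x. v n x * z x)" for n
      by (rule integrable_bounded[OF _ abs_mult_le_bounds[OF C z]]) measurable
    have zz: "integrable M (\<lambda>x. z x * z x)"
      by (rule integrable_bounded[OF _ abs_mult_le_bounds[OF z z]]) measurable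
    \<comment> \<open>Young's inequality with the free parameter \<open>t\<close> stands in for the Cauchy-Schwarz inequality\<close>
    have bound: "real m * (2 * e * t) \<le> A * t\<^sup>2 * m + B * B" for m :: nat and t :: real
    proof (cases "t > 0")
      case t: True
      obtain F where F: "F \<subseteq> ?S" "finite F" "card F = m"
        using infinite_arbitrarily_large[OF inf] by blast
      define V where "V = (\<lambda>x. \<Sum>i\<in>F. v i x)"
      have V2: "(\<integral>x. (V x)\<^sup>2 \<partial>M) \<le> A * m"
      proof -
        have "(\<integral>x. 1 * (V x)\<^sup>2 \<partial>M) = (\<Sum>i\<in>F. \<Sum>j\<in>F. \<integral>x. 1 * (v i x * v j x) \<partial>M)"
          unfolding V_def using F vv by (intro integral_square_sum) auto
        also have "\<dots> \<le> (\<Sum>i\<in>F. C * C) + 2 * E * (card F + card F)"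
        proof (rule gram_sum_le)
          fix i
          have "\<bar>\<integral>x. v i x * v i x \<partial>M\<bar> \<le> C * C"
            by (rule abs_integral_le_bound[OF _ abs_mult_le_bounds[OF C C]]) measurable
          then show "(\<integral>x. 1 * (v i x * v i x) \<partial>M) \<le> C * C" by (simp add: abs_le_iff)
        qed (use F E gram in auto)
        also have "\<dots> = A * m" using F by (simp add: A_def algebra_simps)
        finally show ?thesis by simp
      qed
      have V2i: "integrable M (\<lambda>x. (V x)\<^sup>2)"
        unfolding V_def sum_square_eq using vv by simp
      have "real m * e = (\<Sum>i\<in>F. e)" using F by simp
      also have "\<dots> \<le> (\<Sum>i\<in>F. \<integral>x. v i x * z x \<partial>M)"
        using F by (intro sum_mono) auto
      also have "\<dots> = (\<integral>x. V x * z x \<partial>M)"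
        unfolding V_def sum_distrib_right using vz by (simp add: Bochner_Integration.integral_sum)
      finally have 1: "real m * e \<le> (\<integral>x. V x * z x \<partial>M)" .
      have "2 * t * (\<integral>x. V x * z x \<partial>M) = (\<integral>x. 2 * t * (V x * z x) \<partial>M)" by simp
      also have "\<dots> \<le> (\<integral>x. t\<^sup>2 * (V x)\<^sup>2 + z x * z x \<partial>M)"
      proof (rule integral_mono)
        have "integrable M (\<lambda>x. V x * z x)"
          unfolding V_def sum_distrib_right using vz by simp
        then show "integrable M (\<lambda>x. 2 * t * (V x * z x))" by simp
        show "integrable M (\<lambda>x. t\<^sup>2 * (V x)\<^sup>2 + z x * z x)" using V2i zz by simp
        fix x
        have "0 \<le> (t * V x - z x)\<^sup>2" by simp
        then show "2 * t * (V x * z x) \<le> t\<^sup>2 * (V x)\<^sup>2 + z x * z x"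
          by (simp add: power2_diff power_mult_distrib power2_eq_square algebra_simps)
      qed
      also have "\<dots> = t\<^sup>2 * (\<integral>x. (V x)\<^sup>2 \<partial>M) + (\<integral>x. z x * z x \<partial>M)"
        using V2i zz by simp
      also have "\<dots> \<le> t\<^sup>2 * (A * m) + B * B"
        using V2 abs_integral_le_bound[OF _ abs_mult_le_bounds[OF z z]]
        by (intro add_mono mult_left_mono) (auto simp: abs_le_iff)
      finally have "2 * t * (\<integral>x. V x * z x \<partial>M) \<le> t\<^sup>2 * (A * m) + B * B" .
      moreover have "2 * t * (real m * e) \<le> 2 * t * (\<integral>x. V x * z x \<partial>M)"
        using 1 t by (intro mult_left_mono) auto
      ultimately show ?thesis by (simp add: algebra_simps)
    next
      case False
      then have "real m * (2 * e * t) \<le> 0"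
        using e by (intro mult_nonneg_nonpos) (auto simp: mult_nonneg_nonpos)
      also have "0 \<le> A * t\<^sup>2 * m + B * B" using A0 zero_le_square[of B] by simp
      finally show ?thesis .
    qed
    \<comment> \<open>this \<open>t\<close> makes the quadratic term at most half of the left-hand side, whatever m is\<close>
    define t where "t = e / (A + 1)"
    have t: "t > 0" "A * t \<le> e" using e A0 by (auto simp: t_def field_simps)
    obtain m :: nat where m: "B * B / (e * t) < m" using reals_Archimedean2 by blast
    then have "B * B < real m * (e * t)" using e t by (simp add: field_simps)
    moreover have "A * t\<^sup>2 * m \<le> real m * (e * t)"
      using mult_right_mono[OF t(2), of "t * m"] t by (simp add: power2_eq_square algebra_simps)
    ultimately show False using bound[of m t] by (simp add: algebra_simps)
  qed
  show ?thesis
  proof (rule LIMSEQ_I)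
    fix e :: real assume e: "0 < e"
    have "eventually (\<lambda>n. (\<integral>x. v n x * y x \<partial>M) < e) sequentially"
      using key[of y e] y e by simp
    moreover have "eventually (\<lambda>n. (\<integral>x. v n x * (- y x) \<partial>M) < e) sequentially"
      using key[of "\<lambda>x. - y x" e] y e by simp
    ultimately have "eventually (\<lambda>n. norm ((\<integral>x. v n x * y x \<partial>M) - 0) < e) sequentially"
      by eventually_elim auto
    then show "\<exists>no. \<forall>n\<ge>no. norm ((\<integral>x. v n x * y x \<partial>M) - 0) < e"
      by (simp add: eventually_sequentially)
  qed
qed

text \<open>
  The weak limit is constructed as an almost everywhere limit of Cesaro means, without duality or
  projections. After passing to a subsequence with nearly constant Gram matrix the means are Cauchy
  in L1, so a subsequence of them converges almost everywhere to some \<open>h\<close>. The integrals of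
  \<^term>\<open>u n x * h x\<close> and of \<^term>\<open>h x * h x\<close> are then limits of averages of matrix entries. They show
  that the differences \<^term>\<open>\<lambda>x. u n x - h x\<close> are nearly orthogonal, hence weakly null.
\<close>

lemma bounded_weak_compactness:
  fixes u :: "nat \<Rightarrow> 'a \<Rightarrow> real"
  assumes meas: "\<And>n. u n \<in> borel_measurable M"
    and range: "\<And>n x. u n x \<in> {l..c}"
  shows "\<exists>s h. strict_mono s \<and> h \<in> borel_measurable M \<and> (\<forall>x. h x \<in> {l..c})
    \<and> weakly_tendsto M (\<lambda>n. u (s n)) h"
proof -
  define C where "C = \<bar>l\<bar> + \<bar>c\<bar>"
  have lc: "l \<le> c" using range[of 0 undefined] by simp
  have C_if: "\<bar>a\<bar> \<le> C" if "a \<in> {l..c}" for a using that by (auto simp: C_def)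
  have uC: "\<bar>u n x\<bar> \<le> C" for n x using C_if range by blast
  note meas[measurable]
  obtain s A \<alpha> where s: "strict_mono s" "\<And>i. (\<lambda>n. \<integral>x. u (s i) x * u (s n) x \<partial>M) \<longlonglongrightarrow> A i" "A \<longlonglongrightarrow> \<alpha>"
    "\<And>i j. i < j \<Longrightarrow> \<bar>(\<integral>x. u (s i) x * u (s j) x \<partial>M) - A i\<bar> \<le> (1/2) ^ j"
    "\<And>i. \<bar>A i - \<alpha>\<bar> \<le> (1/2) ^ i"
  proof -
    have "\<bar>\<integral>x. u i x * u j x \<partial>M\<bar> \<le> C * C" for i j
      by (rule abs_integral_le_bound[OF _ abs_mult_le_bounds[OF uC uC]]) measurable
    then show thesis
      using iterated_limit_subsequence[of "\<lambda>i j. \<integral>x. u i x * u j x \<partial>M" "C * C"] that by blast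
  qed
  define v where "v = (\<lambda>n. u (s n))"
  have v[measurable]: "\<And>n. v n \<in> borel_measurable M" and vlc: "\<And>n x. v n x \<in> {l..c}"
    and vC: "\<And>n x. \<bar>v n x\<bar> \<le> C"
    unfolding v_def using range uC by auto
  have vlim: "(\<lambda>n. \<integral>x. v i x * v n x \<partial>M) \<longlonglongrightarrow> A i" for i using s(2) by (simp add: v_def)
  have near: "\<bar>(\<integral>x. v i x * v j x \<partial>M) - A i\<bar> \<le> (1/2) ^ j" if "i < j" for i j
    using s(4)[OF that] by (simp add: v_def)
  have gram: "\<bar>(\<integral>x. v i x * v j x \<partial>M) - \<alpha>\<bar> \<le> (1/2) ^ i + (1/2) ^ j" if "i \<noteq> j" for i j
  proof -
    have "\<bar>(\<integral>x. v i x * v j x \<partial>M) - \<alpha>\<bar> \<le> (1/2) ^ i + (1/2) ^ j" if "i < j" for i j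
      using near[OF that] s(5)[of i] by linarith
    from this[of i j] this[of j i] that show ?thesis
      by (cases "i < j") (auto simp: mult.commute add.commute)
  qed
  define T where "T = (\<lambda>K x. (\<Sum>k<K. v k x) / real K)"
  have T[measurable]: "T K \<in> borel_measurable M" for K unfolding T_def by measurable
  have Tlc: "T K x \<in> {l..c}" if "K > 0" for K x
  proof -
    have "real K * l \<le> (\<Sum>k<K. v k x)" "(\<Sum>k<K. v k x) \<le> real K * c"
      using sum_mono[of "{..<K}" "\<lambda>_. l" "\<lambda>k. v k x"] sum_mono[of "{..<K}" "\<lambda>k. v k x" "\<lambda>_. c"] vlc
      by auto
    then show ?thesis using that by (auto simp: T_def field_simps)
  qed
  have TC: "\<bar>T K x\<bar> \<le> C" for K x
    using Tlc[of K x, THEN C_if] by (cases "K = 0") (auto simp: T_def C_def)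
  obtain r where r: "strict_mono r" "AE x in M. Cauchy (\<lambda>i. T (r i) x)"
  proof (rule cauchy_L1_AE_cauchy_subseq[of M T])
    show "integrable M (T n)" for n by (rule integrable_bounded[OF _ TC]) measurable
    show "\<exists>N. \<forall>i\<ge>N. \<forall>j\<ge>N. (\<integral>x. norm (T i x - T j x) \<partial>M) < e" if "e > 0" for e
      unfolding T_def by (rule cesaro_means_L1_Cauchy[OF v vC gram that])
  qed auto
  \<comment> \<open>clipping keeps the range also where the means diverge\<close>
  define h where "h = (\<lambda>x. max l (min c (lim (\<lambda>i. T (r i) x))))"
  have h[measurable]: "h \<in> borel_measurable M" unfolding h_def by measurable
  have hlc: "h x \<in> {l..c}" for x using lc by (auto simp: h_def)
  have hC: "\<bar>h x\<bar> \<le> C" for x using C_if hlc by blast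
  have Th: "AE x in M. (\<lambda>i. T (r i) x) \<longlonglongrightarrow> h x"
    using r(2)
  proof eventually_elim
    case (elim x)
    then have L: "(\<lambda>i. T (r i) x) \<longlonglongrightarrow> lim (\<lambda>i. T (r i) x)"
      by (simp add: Cauchy_convergent_iff convergent_LIMSEQ_iff)
    have "r i > 0" if "i > 0" for i using seq_suble[OF r(1), of i] that by linarith
    then have "\<exists>N. \<forall>i\<ge>N. T (r i) x \<in> {l..c}" using Tlc by (intro exI[of _ 1]) auto
    then have "lim (\<lambda>i. T (r i) x) \<in> {l..c}"
      using LIMSEQ_le_const[OF L, of l] LIMSEQ_le_const2[OF L, of c] by auto
    then show ?case using L by (simp add: h_def)
  qed
  have Tint: "(\<lambda>i. \<integral>x. y x * T (r i) x \<partial>M) \<longlonglongrightarrow> (\<integral>x. y x * h x \<partial>M)"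
    if [measurable]: "y \<in> borel_measurable M" and y: "\<And>x. \<bar>y x\<bar> \<le> B" for y B
  proof (rule integral_dominated_convergence[where w = "\<lambda>_. B * C"])
    show "AE x in M. (\<lambda>i. y x * T (r i) x) \<longlonglongrightarrow> y x * h x"
      using Th by eventually_elim (intro tendsto_intros)
    show "AE x in M. norm (y x * T (r i) x) \<le> B * C" for i
      using abs_mult_le_bounds[OF y TC] by (intro AE_I2) auto
  qed auto
  have Tavg: "(\<integral>x. y x * T K x \<partial>M) = (\<Sum>k<K. \<integral>x. y x * v k x \<partial>M) / K"
    if [measurable]: "y \<in> borel_measurable M" and y: "\<And>x. \<bar>y x\<bar> \<le> B" for y B K
  proof -
    have yv: "integrable M (\<lambda>x. y x * v k x)" for k
      by (rule integrable_bounded[OF _ abs_mult_le_bounds[OF y vC]]) measurable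
    have "(\<integral>x. y x * T K x \<partial>M) = (\<integral>x. (\<Sum>k<K. y x * v k x) / real K \<partial>M)"
      by (simp add: T_def sum_distrib_left)
    also have "\<dots> = (\<Sum>k<K. \<integral>x. y x * v k x \<partial>M) / K"
      using yv by (simp add: Bochner_Integration.integral_sum)
    finally show ?thesis .
  qed
  \<comment> \<open>a test function whose integrals against the sequence converge has the same limit against the means\<close>
  have lim_eq: "(\<integral>x. y x * h x \<partial>M) = a"
    if y: "y \<in> borel_measurable M" "\<And>x. \<bar>y x\<bar> \<le> B" and lim: "(\<lambda>k. \<integral>x. y x * v k x \<partial>M) \<longlonglongrightarrow> a" for y B a
  proof -
    have "(\<lambda>i. \<integral>x. y x * T (r i) x \<partial>M) \<longlonglongrightarrow> a"
      using LIMSEQ_subseq_LIMSEQ[OF cesaro_mean_tendsto[OF lim] r(1)]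
      by (simp add: Tavg[OF y] o_def)
    then show ?thesis using Tint[OF y] LIMSEQ_unique by blast
  qed
  have vh: "(\<integral>x. v k x * h x \<partial>M) = A k" for k
    by (rule lim_eq[OF _ vC vlim]) measurable
  have hh: "(\<integral>x. h x * h x \<partial>M) = \<alpha>"
    using s(3) vh by (intro lim_eq[OF _ hC]) (auto simp: mult.commute)
  have prods: "integrable M (\<lambda>x. v i x * v j x)" "integrable M (\<lambda>x. v i x * h x)"
    "integrable M (\<lambda>x. h x * h x)" for i j
    by (rule integrable_bounded[OF _ abs_mult_le_bounds[OF vC vC]]
      integrable_bounded[OF _ abs_mult_le_bounds[OF vC hC]]
      integrable_bounded[OF _ abs_mult_le_bounds[OF hC hC]]; measurable)+
  have gram_h: "(\<integral>x. (v i x - h x) * (v j x - h x) \<partial>M) = (\<integral>x. v i x * v j x \<partial>M) - A i - A j + \<alpha>" for i j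
  proof -
    have "(\<integral>x. (v i x - h x) * (v j x - h x) \<partial>M)
      = (\<integral>x. v i x * v j x - v i x * h x - v j x * h x + h x * h x \<partial>M)"
      by (simp add: algebra_simps)
    also have "\<dots> = (\<integral>x. v i x * v j x \<partial>M) - A i - A j + \<alpha>"
      using prods by (simp add: vh hh)
    finally show ?thesis .
  qed
  have orth: "(\<integral>x. (v i x - h x) * (v j x - h x) \<partial>M) \<le> 2 * ((1/2) ^ i + (1/2) ^ j)" if "i \<noteq> j" for i j
  proof -
    have "(\<integral>x. (v i x - h x) * (v j x - h x) \<partial>M) \<le> 2 * ((1/2) ^ i + (1/2) ^ j)" if "i < j" for i j
    proof -
      have "(\<integral>x. v i x * v j x \<partial>M) - A i - A j + \<alpha> \<le> (1/2) ^ j + (1/2) ^ j"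
        using near[OF that] s(5)[of j] unfolding abs_le_iff by linarith
      also have "\<dots> \<le> 2 * ((1/2) ^ i + (1/2) ^ j)" by simp
      finally show ?thesis unfolding gram_h .
    qed
    from this[of i j] this[of j i] that show ?thesis
      by (cases "i < j") (auto simp: mult.commute add.commute)
  qed
  have "weakly_tendsto M v h"
    unfolding weakly_tendsto_def
  proof (intro allI impI)
    fix y :: "'a \<Rightarrow> real" and B
    assume y[measurable]: "y \<in> borel_measurable M" and "\<forall>x. \<bar>y x\<bar> \<le> B"
    then have yB: "\<And>x. \<bar>y x\<bar> \<le> B" by blast
    have "(\<lambda>n. \<integral>x. (v n x - h x) * y x \<partial>M) \<longlonglongrightarrow> 0"
    proof (rule nearly_orthogonal_weakly_null[where C = "C + C" and B = B and E = 2])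
      show "\<bar>v n x - h x\<bar> \<le> C + C" for n x using vC[of n x] hC[of x] by linarith
    qed (use yB orth in auto)
    moreover have "(\<integral>x. (v n x - h x) * y x \<partial>M) = (\<integral>x. v n x * y x \<partial>M) - (\<integral>x. h x * y x \<partial>M)" for n
    proof -
      have "integrable M (\<lambda>x. v n x * y x)" "integrable M (\<lambda>x. h x * y x)"
        by (rule integrable_bounded[OF _ abs_mult_le_bounds[OF vC yB]]
          integrable_bounded[OF _ abs_mult_le_bounds[OF hC yB]]; measurable)+
      then show ?thesis by (simp add: left_diff_distrib)
    qed
    ultimately show "(\<lambda>n. \<integral>x. v n x * y x \<partial>M) \<longlonglongrightarrow> (\<integral>x. h x * y x \<partial>M)"
      by (simp add: LIM_zero_iff)
  qed
  then show ?thesis using s(1) h hlc unfolding v_def by blast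
qed

lemma countable_weak_compactness:
  fixes u :: "nat \<Rightarrow> nat \<Rightarrow> 'a \<Rightarrow> real"
  assumes meas: "\<And>b n. u b n \<in> borel_measurable M"
    and range: "\<And>b n x. u b n x \<in> {l b..c b}"
  shows "\<exists>s h. strict_mono s \<and> (\<forall>b. h b \<in> borel_measurable M) \<and> (\<forall>b x. h b x \<in> {l b..c b})
    \<and> (\<forall>b. weakly_tendsto M (\<lambda>n. u b (s n)) (h b))"
proof -
  define P where "P = (\<lambda>b s. \<exists>h. h \<in> borel_measurable M \<and> (\<forall>x. h x \<in> {l b..c b})
    \<and> weakly_tendsto M (\<lambda>n. u b (s n)) h)"
  interpret subseqs P
  proof
    fix b :: nat and s :: "nat \<Rightarrow> nat"
    show "\<exists>r. strict_mono r \<and> P b (s \<circ> r)"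
      using bounded_weak_compactness[of "\<lambda>n. u b (s n)" "l b" "c b"] meas range
      unfolding P_def o_def by blast
  qed
  have "P b diagseq" for b
  proof -
    have "P b (diagseq \<circ> (+) (Suc b))"
    proof (rule diagseq_holds)
      fix r s :: "nat \<Rightarrow> nat" and n
      assume "strict_mono r" "P n s"
      then show "P n (s \<circ> r)"
        unfolding P_def o_def using weakly_tendsto_subseq by fast
    qed
    then obtain h where h: "h \<in> borel_measurable M" "\<forall>x. h x \<in> {l b..c b}"
        "weakly_tendsto M (\<lambda>n. u b (diagseq (n + Suc b))) h"
      unfolding P_def o_def by (auto simp: add.commute)
    have "weakly_tendsto M (\<lambda>n. u b (diagseq n)) h"
      unfolding weakly_tendsto_def
    proof (intro allI impI)
      fix y B assume "y \<in> borel_measurable M" "\<forall>x. \<bar>y x\<bar> \<le> (B::real)"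
      then have "(\<lambda>n. \<integral>x. u b (diagseq (n + Suc b)) x * y x \<partial>M) \<longlonglongrightarrow> (\<integral>x. h x * y x \<partial>M)"
        using weakly_tendstoD[OF h(3)] by blast
      then show "(\<lambda>n. \<integral>x. u b (diagseq n) x * y x \<partial>M) \<longlonglongrightarrow> (\<integral>x. h x * y x \<partial>M)"
        by (rule LIMSEQ_offset)
    qed
    then show ?thesis unfolding P_def using h by blast
  qed
  then have "\<forall>b. \<exists>h. h \<in> borel_measurable M \<and> (\<forall>x. h x \<in> {l b..c b})
    \<and> weakly_tendsto M (\<lambda>n. u b (diagseq n)) h"
    unfolding P_def by blast
  then obtain h where "\<forall>b. h b \<in> borel_measurable M \<and> (\<forall>x. h b x \<in> {l b..c b})
    \<and> weakly_tendsto M (\<lambda>n. u b (diagseq n)) (h b)"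
    by metis
  then show ?thesis using subseq_diagseq by blast
qed

text \<open>
  Testing against the indicator of the set where the inequality fails shows that this set is null.
\<close>

lemma weak_limit_mono:
  assumes u: "weakly_tendsto M u h" "weakly_tendsto M u' h'"
    and [measurable]: "\<And>n. u n \<in> borel_measurable M" "\<And>n. u' n \<in> borel_measurable M"
      "h \<in> borel_measurable M" "h' \<in> borel_measurable M"
    and C: "\<And>n x. \<bar>u n x\<bar> \<le> C" "\<And>n x. \<bar>u' n x\<bar> \<le> C" "\<And>x. \<bar>h x\<bar> \<le> C" "\<And>x. \<bar>h' x\<bar> \<le> C"
    and le: "\<And>n x. u n x \<le> u' n x"
  shows "AE x in M. h x \<le> h' x"
proof -
  define y :: "'a \<Rightarrow> real" where "y = (\<lambda>x. if h' x < h x then 1 else 0)"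
  have [measurable]: "y \<in> borel_measurable M" unfolding y_def by measurable
  have y1: "\<bar>y x\<bar> \<le> 1" for x by (simp add: y_def)
  have int: "integrable M (\<lambda>x. g x * y x)"
    if [measurable]: "g \<in> borel_measurable M" and "\<And>x. \<bar>g x\<bar> \<le> C" for g
    by (rule integrable_bounded[OF _ abs_mult_le_bounds[OF that(2) y1]]) measurable
  have "(\<integral>x. h x * y x \<partial>M) \<le> (\<integral>x. h' x * y x \<partial>M)"
  proof (rule LIMSEQ_le)
    show "(\<lambda>n. \<integral>x. u n x * y x \<partial>M) \<longlonglongrightarrow> (\<integral>x. h x * y x \<partial>M)"
      by (rule weakly_tendstoD[OF u(1) _ y1]) measurable
    show "(\<lambda>n. \<integral>x. u' n x * y x \<partial>M) \<longlonglongrightarrow> (\<integral>x. h' x * y x \<partial>M)"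
      by (rule weakly_tendstoD[OF u(2) _ y1]) measurable
    have "(\<integral>x. u n x * y x \<partial>M) \<le> (\<integral>x. u' n x * y x \<partial>M)" for n
      by (intro integral_mono int C) (auto intro!: mult_right_mono le simp: y_def)
    then show "\<exists>N. \<forall>n\<ge>N. (\<integral>x. u n x * y x \<partial>M) \<le> (\<integral>x. u' n x * y x \<partial>M)" by blast
  qed
  moreover have "(\<integral>x. (h x - h' x) * y x \<partial>M) = (\<integral>x. h x * y x \<partial>M) - (\<integral>x. h' x * y x \<partial>M)"
    using int[OF _ C(3)] int[OF _ C(4)] by (simp add: left_diff_distrib)
  moreover have nn: "0 \<le> (h x - h' x) * y x" for x by (simp add: y_def)
  ultimately have "(\<integral>x. (h x - h' x) * y x \<partial>M) = 0"
    using integral_nonneg_AE[of "\<lambda>x. (h x - h' x) * y x" M] by auto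
  moreover have "integrable M (\<lambda>x. (h x - h' x) * y x)"
    using int[OF _ C(3)] int[OF _ C(4)] by (simp add: left_diff_distrib)
  ultimately have "AE x in M. (h x - h' x) * y x = 0"
    using nn by (subst (asm) integral_nonneg_eq_0_iff_AE) auto
  then show ?thesis
    by eventually_elim (auto simp: y_def split: if_splits)
qed

lemma weakly_tendsto_difference:
  assumes u: "weakly_tendsto M u h"
    and [measurable]: "\<And>n. u n \<in> borel_measurable M" "h \<in> borel_measurable M" "y \<in> borel_measurable M"
    and C: "\<And>n x. \<bar>u n x\<bar> \<le> C" "\<And>x. \<bar>h x\<bar> \<le> C" and y: "\<And>x. \<bar>y x\<bar> \<le> B"
  shows "(\<lambda>n. \<integral>x. y x * (u n x - h x) \<partial>M) \<longlonglongrightarrow> 0"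
proof -
  have "(\<integral>x. u n x * y x \<partial>M) - (\<integral>x. h x * y x \<partial>M) = (\<integral>x. y x * (u n x - h x) \<partial>M)" for n
  proof -
    have "integrable M (\<lambda>x. u n x * y x)" "integrable M (\<lambda>x. h x * y x)"
      by (rule integrable_bounded[OF _ abs_mult_le_bounds[OF C(1) y]]
        integrable_bounded[OF _ abs_mult_le_bounds[OF C(2) y]]; measurable)+
    then have "(\<integral>x. u n x * y x \<partial>M) - (\<integral>x. h x * y x \<partial>M) = (\<integral>x. u n x * y x - h x * y x \<partial>M)"
      by simp
    then show ?thesis by (simp add: algebra_simps)
  qed
  moreover have "(\<lambda>n. (\<integral>x. u n x * y x \<partial>M) - (\<integral>x. h x * y x \<partial>M)) \<longlonglongrightarrow> 0"
    using weakly_tendstoD[OF u _ y] by (simp add: LIM_zero)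
  ultimately show ?thesis by simp
qed

end

section \<open>A strong law along geometric indices\<close>

lemma AE_summable_if_integrals_bounded:
  fixes g :: "nat \<Rightarrow> 'a \<Rightarrow> real"
  assumes int: "\<And>i. integrable M (g i)" and nonneg: "\<And>i x. 0 \<le> g i x"
    and bnd: "\<And>I. (\<Sum>i<I. \<integral>x. g i x \<partial>M) \<le> C"
  shows "AE x in M. summable (\<lambda>i. g i x)"
proof -
  have [measurable]: "g i \<in> borel_measurable M" for i using int by auto
  have sm: "summable (\<lambda>i. \<integral>x. g i x \<partial>M)"
    using bnd nonneg by (intro bounded_imp_summable[of _ C]) (auto simp del: sum.lessThan_Suc simp flip: lessThan_Suc_atMost)
  have "(\<integral>\<^sup>+x. (\<Sum>i. ennreal (g i x)) \<partial>M) = (\<Sum>i. \<integral>\<^sup>+x. ennreal (g i x) \<partial>M)"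
    by (intro nn_integral_suminf) auto
  also have "\<dots> = (\<Sum>i. ennreal (\<integral>x. g i x \<partial>M))"
    using int nonneg by (intro suminf_cong nn_integral_eq_integral) auto
  also have "\<dots> = ennreal (\<Sum>i. \<integral>x. g i x \<partial>M)"
    using sm nonneg by (intro suminf_ennreal2) auto
  finally have "(\<integral>\<^sup>+x. (\<Sum>i. ennreal (g i x)) \<partial>M) \<noteq> \<infinity>" by simp
  then have "AE x in M. (\<Sum>i. ennreal (g i x)) \<noteq> \<infinity>"
    by (intro nn_integral_PInf_AE) auto
  then show ?thesis
    by eventually_elim (use nonneg in \<open>auto intro!: summable_suminf_not_top\<close>)
qed

text \<open>
  The ceiling makes these indices positive and at least \<^term>\<open>\<alpha> ^ i\<close>, so that no small index needs
  separate treatment.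
\<close>

definition geom_index :: "real \<Rightarrow> nat \<Rightarrow> nat" where
  "geom_index \<alpha> i = nat \<lceil>\<alpha> ^ i\<rceil>"

lemma geom_index_bounds:
  fixes \<alpha> :: real
  assumes "1 < \<alpha>"
  shows "\<alpha> ^ i \<le> geom_index \<alpha> i" "geom_index \<alpha> i \<le> \<alpha> ^ i + 1" "0 < geom_index \<alpha> i"
proof -
  have 1: "1 \<le> \<alpha> ^ i" using assms by simp
  have "real (geom_index \<alpha> i) = of_int \<lceil>\<alpha> ^ i\<rceil>"
    using 1 unfolding geom_index_def by (intro of_nat_nat) linarith
  then show "\<alpha> ^ i \<le> geom_index \<alpha> i" "geom_index \<alpha> i \<le> \<alpha> ^ i + 1"
    using ceiling_correct[of "\<alpha> ^ i"] by linarith+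
  then show "0 < geom_index \<alpha> i" using 1 by linarith
qed

lemma geom_index_mono: "1 < \<alpha> \<Longrightarrow> i \<le> j \<Longrightarrow> geom_index \<alpha> i \<le> geom_index \<alpha> j"
  unfolding geom_index_def by (intro nat_mono ceiling_mono power_increasing) auto

lemma filterlim_geom_index:
  assumes "1 < \<alpha>"
  shows "filterlim (geom_index \<alpha>) at_top sequentially"
  unfolding filterlim_at_top
proof
  fix Z :: nat
  obtain N where N: "real Z < \<alpha> ^ N" using real_arch_pow[OF assms] by blast
  have "Z \<le> geom_index \<alpha> i" if "i \<ge> N" for i
  proof -
    have "\<alpha> ^ N \<le> \<alpha> ^ i" using that assms by (intro power_increasing) auto
    then have "real Z \<le> real (geom_index \<alpha> i)" using N geom_index_bounds(1)[OF assms, of i] by linarith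
    then show ?thesis by simp
  qed
  then show "eventually (\<lambda>i. Z \<le> geom_index \<alpha> i) sequentially"
    by (auto simp: eventually_sequentially)
qed

lemma sum_powers_le:
  fixes \<beta> :: real
  assumes \<beta>: "0 \<le> \<beta>" "\<beta> < 1" and S: "finite S" "\<And>i. i \<in> S \<Longrightarrow> m \<le> i"
  shows "(\<Sum>i\<in>S. \<beta> ^ i) \<le> \<beta> ^ m / (1 - \<beta>)"
proof -
  have inj: "inj_on (\<lambda>i. i - m) S" by (rule inj_onI) (metis S(2) le_add_diff_inverse)
  have "(\<Sum>i\<in>S. \<beta> ^ i) = (\<Sum>j\<in>(\<lambda>i. i - m) ` S. \<beta> ^ (m + j))"
    using inj S(2) by (simp add: sum.reindex)
  also have "\<dots> = \<beta> ^ m * (\<Sum>j\<in>(\<lambda>i. i - m) ` S. \<beta> ^ j)"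
    by (simp add: power_add sum_distrib_left)
  also have "\<dots> \<le> \<beta> ^ m * (\<Sum>j. \<beta> ^ j)"
    using \<beta> S by (intro mult_left_mono sum_le_suminf summable_geometric) auto
  also have "\<dots> = \<beta> ^ m / (1 - \<beta>)" using \<beta> by (simp add: suminf_geometric)
  finally show ?thesis .
qed

text \<open>
  The sum runs over a tail of a sequence that decays geometrically and whose first term is at most of
  order \<open>1 / (k + 1)\<^sup>2\<close>. This is the estimate that lets the weights \<open>1 / (k + 1)\<^sup>2\<close>, and nothing
  stronger, suffice in the law of large numbers.
\<close>

lemma geom_index_inverse_square_sum:
  assumes \<alpha>: "1 < \<alpha>"
  shows "(\<Sum>i\<in>{i. i < I \<and> k < geom_index \<alpha> i}. 1 / (real (geom_index \<alpha> i))\<^sup>2)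
    \<le> 4 / (1 - (1 / \<alpha>\<^sup>2)) / (real (Suc k))\<^sup>2"
proof (cases "{i. i < I \<and> k < geom_index \<alpha> i} = {}")
  case True
  have "1 / \<alpha>\<^sup>2 < 1" using \<alpha> by simp
  then show ?thesis unfolding True by simp
next
  case False
  define S where "S = {i. i < I \<and> k < geom_index \<alpha> i}"
  define m where "m = Min S"
  have fin: "finite S" by (simp add: S_def)
  have m: "m \<in> S" using Min_in[OF fin] False by (simp add: m_def S_def)
  have \<beta>: "1 / \<alpha>\<^sup>2 < 1" using \<alpha> by simp
  have "(\<Sum>i\<in>S. 1 / (real (geom_index \<alpha> i))\<^sup>2) \<le> (\<Sum>i\<in>S. (1 / \<alpha>\<^sup>2) ^ i)"
  proof (rule sum_mono)
    fix i
    have "(\<alpha> ^ i)\<^sup>2 \<le> (real (geom_index \<alpha> i))\<^sup>2"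
      using \<alpha> geom_index_bounds(1)[OF \<alpha>] by (intro power_mono) auto
    then have "1 / (real (geom_index \<alpha> i))\<^sup>2 \<le> 1 / (\<alpha> ^ i)\<^sup>2"
      using \<alpha> by (intro divide_left_mono) (auto simp: geom_index_bounds(3)[OF \<alpha>])
    also have "\<dots> = (1 / \<alpha>\<^sup>2) ^ i" by (simp add: power_one_over power_mult[symmetric] mult.commute)
    finally show "1 / (real (geom_index \<alpha> i))\<^sup>2 \<le> (1 / \<alpha>\<^sup>2) ^ i" .
  qed
  also have "\<dots> \<le> (1 / \<alpha>\<^sup>2) ^ m / (1 - 1 / \<alpha>\<^sup>2)"
    using \<alpha> \<beta> fin by (intro sum_powers_le) (auto simp: m_def)
  also have "\<dots> \<le> 4 / (real (Suc k))\<^sup>2 / (1 - 1 / \<alpha>\<^sup>2)"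
  proof (rule divide_right_mono)
    have "real (Suc k) \<le> real (geom_index \<alpha> m)" using m by (simp add: S_def)
    also have "\<dots> \<le> \<alpha> ^ m + 1" by (rule geom_index_bounds(2)[OF \<alpha>])
    also have "\<dots> \<le> 2 * \<alpha> ^ m" using \<alpha> by simp
    finally have "(real (Suc k))\<^sup>2 \<le> (2 * \<alpha> ^ m)\<^sup>2" by (intro power_mono) auto
    then have "(real (Suc k))\<^sup>2 \<le> 4 * (\<alpha> ^ m)\<^sup>2" by (simp add: power_mult_distrib)
    moreover have "(1 / \<alpha>\<^sup>2) ^ m = 1 / (\<alpha> ^ m)\<^sup>2" by (simp add: power_one_over power_mult[symmetric] mult.commute)
    moreover have "0 < (\<alpha> ^ m)\<^sup>2" using \<alpha> by simp
    ultimately show "(1 / \<alpha>\<^sup>2) ^ m \<le> 4 / (real (Suc k))\<^sup>2"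
      by (simp del: of_nat_Suc add: field_simps)
  qed (use \<beta> in auto)
  finally show ?thesis by (simp add: S_def mult.commute)
qed

text \<open>
  Chebyshev's inequality and the Borel-Cantelli lemma in integrated form: the weighted squares of the
  means along geometric indices have a finite sum of integrals. Orthogonality enters only through the
  bound \<open>le\<close> on the integral of the squared partial sums.
\<close>

lemma means_along_geom_index_AE:
  fixes X :: "nat \<Rightarrow> 'a \<Rightarrow> real"
  assumes w: "\<And>x. 0 \<le> w x"
    and int: "\<And>K. integrable M (\<lambda>x. w x * (\<Sum>k<K. X k x)\<^sup>2)"
    and le: "\<And>K. (\<integral>x. w x * (\<Sum>k<K. X k x)\<^sup>2 \<partial>M) \<le> (\<Sum>k<K. a k)"
    and a: "\<And>k. 0 \<le> a k" "summable (\<lambda>k. a k / (real (Suc k))\<^sup>2)"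
    and \<alpha>: "1 < \<alpha>"
  shows "AE x in M. 0 < w x \<longrightarrow>
    (\<lambda>i. (\<Sum>k<geom_index \<alpha> i. X k x) / real (geom_index \<alpha> i)) \<longlonglongrightarrow> 0"
proof -
  define K where "K = geom_index \<alpha>"
  define D where "D = 4 / (1 - (1 / \<alpha>\<^sup>2))"
  have "1 / \<alpha>\<^sup>2 < 1" using \<alpha> by simp
  then have D: "0 \<le> D" by (simp add: D_def)
  define g where "g = (\<lambda>i x. w x * (\<Sum>k<K i. X k x)\<^sup>2 / (real (K i))\<^sup>2)"
  have "AE x in M. summable (\<lambda>i. g i x)"
  proof (rule AE_summable_if_integrals_bounded)
    show "integrable M (g i)" for i unfolding g_def using int by simp
    show "0 \<le> g i x" for i x using w by (simp add: g_def)
    fix I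
    have "(\<Sum>i<I. \<integral>x. g i x \<partial>M) \<le> (\<Sum>i<I. (\<Sum>k<K i. a k) / (real (K i))\<^sup>2)"
      unfolding g_def using le by (intro sum_mono) (simp add: divide_right_mono)
    also have "\<dots> = (\<Sum>i<I. \<Sum>k<K I. if k < K i then a k * (1 / (real (K i))\<^sup>2) else 0)"
    proof (rule sum.cong[OF refl])
      fix i assume "i \<in> {..<I}"
      then have "K i \<le> K I" using geom_index_mono[OF \<alpha>] by (simp add: K_def)
      then have "(\<Sum>k<K I. if k < K i then a k * (1 / (real (K i))\<^sup>2) else 0)
          = (\<Sum>k<K i. a k * (1 / (real (K i))\<^sup>2))"
        by (intro sum.mono_neutral_cong_right) auto
      then show "(\<Sum>k<K i. a k) / (real (K i))\<^sup>2
          = (\<Sum>k<K I. if k < K i then a k * (1 / (real (K i))\<^sup>2) else 0)"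
        by (simp add: sum_divide_distrib)
    qed
    also have "\<dots> = (\<Sum>k<K I. \<Sum>i<I. if k < K i then a k * (1 / (real (K i))\<^sup>2) else 0)"
      by (rule sum.swap)
    also have "\<dots> = (\<Sum>k<K I. a k * (\<Sum>i\<in>{i. i < I \<and> k < K i}. 1 / (real (K i))\<^sup>2))"
    proof (rule sum.cong[OF refl])
      fix k
      have "(\<Sum>i<I. if k < K i then a k * (1 / (real (K i))\<^sup>2) else 0)
          = (\<Sum>i\<in>{i. i < I \<and> k < K i}. a k * (1 / (real (K i))\<^sup>2))"
        by (intro sum.mono_neutral_cong_right) auto
      then show "(\<Sum>i<I. if k < K i then a k * (1 / (real (K i))\<^sup>2) else 0)
          = a k * (\<Sum>i\<in>{i. i < I \<and> k < K i}. 1 / (real (K i))\<^sup>2)"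
        by (simp add: sum_distrib_left)
    qed
    also have "\<dots> \<le> (\<Sum>k<K I. a k * (D / (real (Suc k))\<^sup>2))"
      using a(1) geom_index_inverse_square_sum[OF \<alpha>] unfolding K_def D_def
      by (intro sum_mono mult_left_mono) auto
    also have "\<dots> = D * (\<Sum>k<K I. a k / (real (Suc k))\<^sup>2)"
      by (simp add: sum_distrib_left mult.commute)
    also have "\<dots> \<le> D * (\<Sum>k. a k / (real (Suc k))\<^sup>2)"
      using D a by (intro mult_left_mono sum_le_suminf) auto
    finally show "(\<Sum>i<I. \<integral>x. g i x \<partial>M) \<le> D * (\<Sum>k. a k / (real (Suc k))\<^sup>2)" .
  qed
  then show ?thesis
  proof eventually_elim
    case (elim x)
    show ?case
    proof
      assume pos: "0 < w x"
      have "(\<lambda>i. sqrt (g i x / w x)) \<longlonglongrightarrow> sqrt (0 / w x)"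
        using summable_LIMSEQ_zero[OF elim] pos by (intro tendsto_intros) auto
      moreover have "g i x / w x = ((\<Sum>k<K i. X k x) / real (K i))\<^sup>2" for i
        using pos by (simp add: g_def power_divide)
      ultimately have "(\<lambda>i. \<bar>(\<Sum>k<K i. X k x) / real (K i)\<bar>) \<longlonglongrightarrow> 0"
        by simp
      then show "(\<lambda>i. (\<Sum>k<geom_index \<alpha> i. X k x) / real (geom_index \<alpha> i)) \<longlonglongrightarrow> 0"
        unfolding K_def by (rule tendsto_rabs_zero_cancel)
    qed
  qed
qed

text \<open>
  Etemadi's interpolation. Since the \<^term>\<open>y k\<close> are nonnegative their partial sums are monotone, so
  between two consecutive geometric indices the mean changes at most by a factor close to the ratio
  \<open>1 + 1 / (p + 1)\<close>, and p is arbitrary.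
\<close>

lemma cesaro_tendsto_if_along_geom_index:
  fixes y c :: "nat \<Rightarrow> real"
  assumes y: "\<And>k. 0 \<le> y k" and c: "c \<longlonglongrightarrow> l" and l: "0 \<le> l"
    and lim: "\<And>p. (\<lambda>i. (\<Sum>k<geom_index (1 + 1 / real (Suc p)) i. y k - c k)
        / real (geom_index (1 + 1 / real (Suc p)) i)) \<longlonglongrightarrow> 0"
  shows "(\<lambda>n. (\<Sum>k<n. y k) / real n) \<longlonglongrightarrow> l"
proof (rule LIMSEQ_I)
  fix \<delta> :: real assume \<delta>: "0 < \<delta>"
  have z: "(\<lambda>p. 1 / real (Suc p)) \<longlonglongrightarrow> 0" by (rule LIMSEQ_Suc) (rule lim_1_over_n)
  have "(\<lambda>p. (l + 1 / real (Suc p)) * ((1 + 1 / real (Suc p)) + 1 / real (Suc p))) \<longlonglongrightarrow> (l + 0) * ((1 + 0) + 0)"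
    by (intro tendsto_intros z)
  then have "eventually (\<lambda>p. (l + 1 / real (Suc p)) * ((1 + 1 / real (Suc p)) + 1 / real (Suc p)) < l + \<delta>) sequentially"
    using \<delta> by (intro order_tendstoD(2)) auto
  moreover have "(\<lambda>p. (l - 1 / real (Suc p)) / (1 + 1 / real (Suc p))) \<longlonglongrightarrow> (l - 0) / (1 + 0)"
    by (intro tendsto_intros z) simp
  then have "eventually (\<lambda>p. l - \<delta> < (l - 1 / real (Suc p)) / (1 + 1 / real (Suc p))) sequentially"
    using \<delta> by (intro order_tendstoD(1)) auto
  ultimately have "eventually (\<lambda>p. (l + 1 / real (Suc p)) * ((1 + 1 / real (Suc p)) + 1 / real (Suc p)) < l + \<delta>
      \<and> l - \<delta> < (l - 1 / real (Suc p)) / (1 + 1 / real (Suc p))) sequentially"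
    by eventually_elim auto
  then obtain p where p: "(l + 1 / real (Suc p)) * ((1 + 1 / real (Suc p)) + 1 / real (Suc p)) < l + \<delta>"
    "l - \<delta> < (l - 1 / real (Suc p)) / (1 + 1 / real (Suc p))"
    by (auto simp: eventually_sequentially)
  define \<epsilon> where "\<epsilon> = 1 / real (Suc p)"
  define \<alpha> where "\<alpha> = 1 + 1 / real (Suc p)"
  define K where "K = geom_index \<alpha>"
  define T where "T = (\<lambda>n. \<Sum>k<n. y k)"
  have \<epsilon>: "0 < \<epsilon>" and \<alpha>: "1 < \<alpha>" by (auto simp: \<epsilon>_def \<alpha>_def)
  have up: "(l + \<epsilon>) * (\<alpha> + \<epsilon>) < l + \<delta>" and low: "l - \<delta> < (l - \<epsilon>) / \<alpha>"
    using p by (simp_all add: \<epsilon>_def \<alpha>_def)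
  have T0: "0 \<le> T n" for n using y by (simp add: T_def sum_nonneg)
  have Tmono: "T m \<le> T n" if "m \<le> n" for m n
    unfolding T_def using that y by (intro sum_mono2) auto
  note K_bounds = geom_index_bounds[OF \<alpha>, folded K_def]
  have "(\<lambda>i. (\<Sum>k<K i. c k) / real (K i)) \<longlonglongrightarrow> l"
    using filterlim_compose[OF cesaro_mean_tendsto[OF c] filterlim_geom_index[OF \<alpha>]]
    by (simp add: K_def)
  moreover have "(\<lambda>i. (\<Sum>k<K i. y k - c k) / real (K i)) \<longlonglongrightarrow> 0"
    using lim[of p] by (simp add: K_def \<alpha>_def)
  ultimately have "(\<lambda>i. (\<Sum>k<K i. y k - c k) / real (K i) + (\<Sum>k<K i. c k) / real (K i)) \<longlonglongrightarrow> 0 + l"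
    by (intro tendsto_add)
  then have \<tau>: "(\<lambda>i. T (K i) / real (K i)) \<longlonglongrightarrow> l"
    by (simp add: T_def sum_subtractf add_divide_distrib[symmetric])
  obtain i1 where i1: "\<And>i. i \<ge> i1 \<Longrightarrow> \<bar>T (K i) / real (K i) - l\<bar> < \<epsilon>"
    using LIMSEQ_D[OF \<tau> \<epsilon>] by auto
  obtain n0 :: nat where n0: "\<alpha> ^ i1 + 1 / \<epsilon> + 1 < real n0" using reals_Archimedean2 by blast
  show "\<exists>no. \<forall>n\<ge>no. norm ((\<Sum>k<n. y k) / real n - l) < \<delta>"
  proof (intro exI allI impI)
    fix n assume n: "n \<ge> n0"
    have "0 < 1 / \<epsilon>" "0 < \<alpha> ^ i1" using \<epsilon> \<alpha> by auto
    then have big: "\<alpha> ^ i1 \<le> n" "1 / \<epsilon> \<le> n" "1 \<le> n" using n n0 by linarith+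
    obtain j where j: "real n < \<alpha> ^ j" using real_arch_pow[OF \<alpha>] by blast
    \<comment> \<open>locates n between \<open>\<alpha> ^ i\<close> and \<open>\<alpha> ^ (i + 1)\<close>\<close>
    define J where "J = (LEAST j. real n < \<alpha> ^ j)"
    have J: "real n < \<alpha> ^ J" unfolding J_def by (rule LeastI[of _ j]) (rule j)
    have "i1 < J"
    proof (rule ccontr)
      assume "\<not> i1 < J"
      then have "\<alpha> ^ J \<le> \<alpha> ^ i1" using \<alpha> by (intro power_increasing) auto
      then show False using J big(1) by linarith
    qed
    then obtain i where i: "J = Suc i" "i1 \<le> i" by (cases J) auto
    have below: "\<alpha> ^ i \<le> n"
      using not_less_Least[of i "\<lambda>j. real n < \<alpha> ^ j"] i by (simp add: J_def)
    have above: "real n < \<alpha> * \<alpha> ^ i" using J i by simp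
    have Ki: "K i \<le> n" using below by (simp add: K_def geom_index_def nat_le_iff ceiling_le_iff)
    have Kn: "n \<le> K (Suc i)" using K_bounds(1)[of "Suc i"] J i by simp
    have "T n / n \<le> T (K (Suc i)) / n" using Tmono[OF Kn] by (intro divide_right_mono) auto
    also have "\<dots> = T (K (Suc i)) / K (Suc i) * (K (Suc i) / n)"
      using K_bounds(3)[of "Suc i"] by simp
    also have "\<dots> \<le> (l + \<epsilon>) * (\<alpha> + \<epsilon>)"
    proof (rule mult_mono)
      show "T (K (Suc i)) / K (Suc i) \<le> l + \<epsilon>" using i1[of "Suc i"] i by linarith
      have "real (K (Suc i)) \<le> \<alpha> * \<alpha> ^ i + 1" using K_bounds(2)[of "Suc i"] by simp
      also have "\<dots> \<le> \<alpha> * n + \<epsilon> * n"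
      proof (rule add_mono)
        show "\<alpha> * \<alpha> ^ i \<le> \<alpha> * n" using below \<alpha> by simp
        show "1 \<le> \<epsilon> * n" using big(2) \<epsilon> by (simp add: field_simps)
      qed
      finally show "K (Suc i) / n \<le> \<alpha> + \<epsilon>" using big(3) by (simp add: field_simps)
    qed (use l \<epsilon> in auto)
    finally have 1: "T n / n < l + \<delta>" using up by linarith
    have "(l - \<epsilon>) / \<alpha> \<le> T (K i) / K i / \<alpha>"
      using i1[of i] i \<alpha> by (intro divide_right_mono) (auto simp: abs_less_iff)
    also have "\<dots> = T (K i) / K i * (1 / \<alpha>)" by simp
    also have "\<dots> \<le> T (K i) / K i * (K i / n)"
    proof (rule mult_left_mono)
      have "real n \<le> \<alpha> * K i"
        using above mult_left_mono[OF K_bounds(1)[of i], of \<alpha>] \<alpha> by linarith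
      then show "1 / \<alpha> \<le> K i / n" using \<alpha> big(3) by (simp add: field_simps)
    qed (use T0 in auto)
    also have "\<dots> = T (K i) / n" using K_bounds(3)[of i] by simp
    also have "\<dots> \<le> T n / n" using Tmono[OF Ki] by (intro divide_right_mono) auto
    finally have 2: "l - \<delta> < T n / n" using low by linarith
    show "norm ((\<Sum>k<n. y k) / real n - l) < \<delta>"
      using 1 2 by (simp add: T_def abs_less_iff)
  qed
qed

section \<open>Hereditary convergence of Cesaro means\<close>

text \<open>
  Terms with \<open>b + 1 \<le> x\<close> equal 1, and there are at most \<open>min x B\<close> of them; the others, present only if
  \<open>x < B\<close>, add up to \<open>x\<^sup>2\<close> times a tail of the inverse squares, which is at most of order \<open>1 / x\<close>.
  Because the right-hand side sees only the truncation at \<open>B\<close>, the bound survives weak limits of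
  truncations.
\<close>

lemma sum_truncated_squares_le:
  fixes x :: real
  assumes "0 \<le> x"
  shows "(\<Sum>b<B. (min x (Suc b))\<^sup>2 / (real (Suc b))\<^sup>2) \<le> 3 * min x B"
proof -
  \<comment> \<open>the subtracted term pays for the next summand, as \<open>1 / (B + 1)\<^sup>2 \<le> 1 / B - 1 / (B + 1)\<close>\<close>
  have "(\<Sum>b<B. (min x (Suc b))\<^sup>2 / (real (Suc b))\<^sup>2) \<le> 3 * min x B - (min x B)\<^sup>2 / B"
  proof (induction B)
    case (Suc B)
    consider "real (Suc B) \<le> x" | "real B \<le> x" "x < real (Suc B)" | "x < real B" by linarith
    then show ?case
    proof cases
      case 1
      then have "(\<Sum>b<B. (min x (Suc b))\<^sup>2 / (real (Suc b))\<^sup>2) = (\<Sum>b<B. 1)"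
        by (intro sum.cong) auto
      then show ?thesis using 1 by (simp add: power2_eq_square)
    next
      case 2
      then have *: "(\<Sum>b<B. (min x (Suc b))\<^sup>2 / (real (Suc b))\<^sup>2) = (\<Sum>b<B. 1)"
        by (intro sum.cong) auto
      have m: "min x (real (Suc B)) = x" using 2 by simp
      show ?thesis
      proof (cases "B = 0")
        case True
        have "x * x \<le> x * 1" using 2 True assms by (intro mult_left_mono) auto
        then show ?thesis using m True assms by (simp add: power2_eq_square)
      next
        case False
        define s where "s = real (Suc B)"
        have hB: "real B = s - 1" by (simp add: s_def)
        have s: "2 \<le> s" "x < s" "s - 1 \<le> x" using False 2 by (auto simp: s_def)
        have "x * x \<le> x * s" using s assms by (intro mult_left_mono) auto
        then have a: "x\<^sup>2 / s \<le> x" using s by (simp add: power2_eq_square field_simps)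
        have "x\<^sup>2 \<le> s\<^sup>2" using s assms by (intro power_mono) auto
        then have b: "x\<^sup>2 / s\<^sup>2 \<le> 1" using s by simp
        have "real B + x\<^sup>2 / s\<^sup>2 \<le> 3 * x - x\<^sup>2 / s"
          using a b s(1,3) hB by linarith
        then show ?thesis using * m by (simp add: s_def)
      qed
    next
      case 3
      then have B: "B > 0" using assms by (cases B) auto
      have m: "min x (real (Suc B)) = x" "min x (real B) = x" using 3 by auto
      have "1 / (real (Suc B))\<^sup>2 \<le> 1 / (real B * real (Suc B))"
        using B unfolding power2_eq_square by (intro divide_left_mono mult_right_mono mult_pos_pos) auto
      also have "\<dots> = 1 / B - 1 / Suc B" using B by (simp add: field_simps)
      finally have "1 / (real (Suc B))\<^sup>2 \<le> 1 / B - 1 / Suc B" .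
      then have "x\<^sup>2 * (1 / (real (Suc B))\<^sup>2) \<le> x\<^sup>2 * (1 / B - 1 / Suc B)"
        by (intro mult_left_mono) auto
      then have "x\<^sup>2 / (real (Suc B))\<^sup>2 \<le> x\<^sup>2 / B - x\<^sup>2 / Suc B"
        by (simp add: right_diff_distrib)
      then show ?thesis using Suc unfolding m sum.lessThan_Suc by linarith
    qed
  qed (use assms in simp)
  also have "\<dots> \<le> 3 * min x B" by simp
  finally show ?thesis .
qed

lemma summable_inverse_squares: "summable (\<lambda>k. C / (real (Suc k))\<^sup>2)"
proof -
  have "summable (\<lambda>k. inverse (real (Suc k) ^ 2))"
    using inverse_power_summable[of 2, where ?'a = real] by (subst summable_Suc_iff) simp
  then show ?thesis
    unfolding divide_inverse by (rule summable_mult)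
qed

context prob_space
begin

text \<open>
  A law of large numbers for truncations at levels \<^term>\<open>t k\<close>, with the functions \<^term>\<open>h (t k)\<close>
  in the place of expectations; near orthogonality of the differences stands in for independence. The
  weight \<^term>\<open>w\<close> is an absolutely continuous change of measure. The bound \<open>cross\<close> is imposed on all levels up to \<open>k + 1\<close> and with the k-th error, so it
  passes to every further subsequence \<^term>\<open>r\<close>, because \<open>k \<le> r k\<close>.
\<close>

lemma truncated_cesaro_AE:
  fixes g h :: "nat \<Rightarrow> 'a \<Rightarrow> real" and t r :: "nat \<Rightarrow> nat"
  assumes [measurable]: "\<And>n. g n \<in> borel_measurable M" "\<And>b. h b \<in> borel_measurable M"
      "w \<in> borel_measurable M"
    and g: "\<And>n x. 0 \<le> g n x" and h: "\<And>b x. h b x \<in> {0..real b}" and w: "\<And>x. w x \<in> {0..1}"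
    and cross: "\<And>j k a b. j < k \<Longrightarrow> a \<le> Suc k \<Longrightarrow> b \<le> Suc k \<Longrightarrow>
        (\<integral>x. w x * ((min (g j x) a - h a x) * (min (g k x) b - h b x)) \<partial>M) \<le> (1/2) ^ k"
    and r: "strict_mono r" and t: "\<And>k. t k \<le> Suc k"
    and diag: "\<And>k. (\<integral>x. w x * (min (g (r k) x) (t k) - h (t k) x)\<^sup>2 \<partial>M) \<le> a k"
    and a: "\<And>k. 0 \<le> a k" "summable (\<lambda>k. a k / (real (Suc k))\<^sup>2)"
    and lim: "AE x in M. 0 < w x \<longrightarrow> (\<lambda>k. h (t k) x) \<longlonglongrightarrow> l x" and l: "\<And>x. 0 \<le> l x"
  shows "AE x in M. 0 < w x \<longrightarrow> (\<lambda>n. (\<Sum>k<n. min (g (r k) x) (t k)) / real n) \<longlonglongrightarrow> l x"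
proof -
  define X where "X = (\<lambda>k x. min (g (r k) x) (t k) - h (t k) x)"
  have [measurable]: "X k \<in> borel_measurable M" for k unfolding X_def by measurable
  have Xb: "\<bar>X k x\<bar> \<le> t k" for k x
    using g[of "r k" x] h[of "t k" x] by (auto simp: X_def abs_le_iff)
  have wb: "\<bar>w x\<bar> \<le> 1" for x using w[of x] by auto
  have int: "integrable M (\<lambda>x. w x * (X i x * X j x))" for i j
    by (rule integrable_bounded[OF _ abs_mult_le_bounds[OF wb abs_mult_le_bounds[OF Xb Xb]]]) measurable
  have cross': "(\<integral>x. w x * (X i x * X j x) \<partial>M) \<le> (1/2) ^ i + (1/2) ^ j" if "i < j" for i j
  proof -
    have le: "j \<le> r j" by (rule seq_suble[OF r])
    have "r i < r j" using r that by (simp add: strict_mono_less)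
    moreover have "t i \<le> Suc (r j)" "t j \<le> Suc (r j)" using t[of i] t[of j] le that by linarith+
    ultimately have "(\<integral>x. w x * (X i x * X j x) \<partial>M) \<le> (1/2) ^ r j"
      unfolding X_def by (rule cross)
    also have "\<dots> \<le> (1/2) ^ j" using le by (intro power_decreasing) auto
    also have "\<dots> \<le> (1/2) ^ i + (1/2) ^ j" by simp
    finally show ?thesis .
  qed
  have sq_int: "integrable M (\<lambda>x. w x * (\<Sum>k<K. X k x)\<^sup>2)" for K
    using int by (simp add: sum_square_eq sum_distrib_left)
  have "AE x in M. 0 < w x \<longrightarrow>
      (\<lambda>i. (\<Sum>k<geom_index \<alpha> i. X k x) / real (geom_index \<alpha> i)) \<longlonglongrightarrow> 0" if \<alpha>: "1 < \<alpha>" for \<alpha>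
  proof (rule means_along_geom_index_AE[where a = "\<lambda>k. a k + 4"])
    fix K
    have "(\<integral>x. w x * (\<Sum>k<K. X k x)\<^sup>2 \<partial>M) = (\<Sum>i<K. \<Sum>j<K. \<integral>x. w x * (X i x * X j x) \<partial>M)"
      using int by (intro integral_square_sum) auto
    also have "\<dots> \<le> (\<Sum>i<K. a i) + 2 * 1 * real (card {..<K} + card {..<K})"
    proof (rule gram_sum_le)
      show "(\<integral>x. w x * (X i x * X i x) \<partial>M) \<le> a i" for i
        using diag[of i] by (simp add: X_def power2_eq_square)
      show "(\<integral>x. w x * (X i x * X j x) \<partial>M) \<le> 1 * ((1/2) ^ i + (1/2) ^ j)" if "i \<noteq> j" for i j
        using cross'[of i j] cross'[of j i] that by (cases "i < j") (auto simp: mult.commute add.commute)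
    qed (use a in auto)
    also have "\<dots> = (\<Sum>i<K. a i + 4)" by (simp add: sum.distrib)
    finally show "(\<integral>x. w x * (\<Sum>k<K. X k x)\<^sup>2 \<partial>M) \<le> (\<Sum>i<K. a i + 4)" .
  next
    show "summable (\<lambda>k. (a k + 4) / (real (Suc k))\<^sup>2)"
      using summable_add[OF a(2) summable_inverse_squares[of 4]] by (simp add: add_divide_distrib)
  qed (use w sq_int a \<alpha> in \<open>auto simp: add_nonneg_nonneg\<close>)
  then have "AE x in M. 0 < w x \<longrightarrow>
      (\<lambda>i. (\<Sum>k<geom_index (1 + 1 / real (Suc p)) i. X k x) / real (geom_index (1 + 1 / real (Suc p)) i)) \<longlonglongrightarrow> 0" for p
    by simp
  then have "AE x in M. \<forall>p. 0 < w x \<longrightarrow>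
      (\<lambda>i. (\<Sum>k<geom_index (1 + 1 / real (Suc p)) i. X k x) / real (geom_index (1 + 1 / real (Suc p)) i)) \<longlonglongrightarrow> 0"
    unfolding AE_all_countable by blast
  with lim show ?thesis
  proof eventually_elim
    case (elim x)
    show ?case
    proof
      assume pos: "0 < w x"
      show "(\<lambda>n. (\<Sum>k<n. min (g (r k) x) (t k)) / real n) \<longlonglongrightarrow> l x"
        by (rule cesaro_tendsto_if_along_geom_index[where c = "\<lambda>k. h (t k) x"])
          (use elim pos g l in \<open>auto simp: X_def\<close>)
    qed
  qed
qed

text \<open>
  Uniform control of the truncated first moments controls the series of second moments that appears in
  the law of large numbers. The limits \<^term>\<open>v b\<close> are taken for each level separately, so only
  finitely many levels can be compared at a time; the bound does not depend on their number.
\<close>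

lemma truncated_second_moments_sum_le:
  assumes [measurable]: "\<And>n. f n \<in> borel_measurable M" "w \<in> borel_measurable M"
    and f: "\<And>n x. 0 \<le> f n x" and w: "\<And>x. w x \<in> {0..1}"
    and v: "\<And>b::nat. (\<lambda>n. \<integral>x. (min (f n x) (real b))\<^sup>2 * w x \<partial>M) \<longlonglongrightarrow> v b"
    and m: "(\<lambda>n. \<integral>x. min (f n x) (real B) * w x \<partial>M) \<longlonglongrightarrow> m"
  shows "(\<Sum>b<B. v (Suc b) / (real (Suc b))\<^sup>2) \<le> 3 * m"
proof -
  have minb: "\<bar>min (f n x) (real b)\<bar> \<le> b" for n b x using f[of n x] by auto
  have sqb: "\<bar>(min (f n x) (real b))\<^sup>2\<bar> \<le> (real b)\<^sup>2" for n b x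
    using power_mono[OF minb[of n x b] abs_ge_zero, of 2] by simp
  have wb: "\<bar>w x\<bar> \<le> 1" for x using w[of x] by auto
  have lim1: "(\<lambda>n. \<Sum>b<B. (\<integral>x. (min (f n x) (real (Suc b)))\<^sup>2 * w x \<partial>M) / (real (Suc b))\<^sup>2)
      \<longlonglongrightarrow> (\<Sum>b<B. v (Suc b) / (real (Suc b))\<^sup>2)"
    by (intro tendsto_intros v) simp
  have le: "(\<Sum>b<B. (\<integral>x. (min (f n x) (real (Suc b)))\<^sup>2 * w x \<partial>M) / (real (Suc b))\<^sup>2)
      \<le> 3 * (\<integral>x. min (f n x) (real B) * w x \<partial>M)" for n
  proof -
    have i: "integrable M (\<lambda>x. (min (f n x) (real b))\<^sup>2 * w x)" for b
      by (rule integrable_bounded[OF _ abs_mult_le_bounds[OF sqb wb]]) measurable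
    have i': "integrable M (\<lambda>x. min (f n x) (real B) * w x)"
      by (rule integrable_bounded[OF _ abs_mult_le_bounds[OF minb wb]]) measurable
    have "(\<Sum>b<B. (\<integral>x. (min (f n x) (real (Suc b)))\<^sup>2 * w x \<partial>M) / (real (Suc b))\<^sup>2)
      = (\<integral>x. (\<Sum>b<B. (min (f n x) (real (Suc b)))\<^sup>2 * w x / (real (Suc b))\<^sup>2) \<partial>M)"
      by (subst Bochner_Integration.integral_sum) (intro integrable_divide i, simp)
    also have "\<dots> \<le> (\<integral>x. 3 * (min (f n x) (real B) * w x) \<partial>M)"
    proof (rule integral_mono)
      show "integrable M (\<lambda>x. \<Sum>b<B. (min (f n x) (real (Suc b)))\<^sup>2 * w x / (real (Suc b))\<^sup>2)"
        by (intro Bochner_Integration.integrable_sum integrable_divide i)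
      show "integrable M (\<lambda>x. 3 * (min (f n x) (real B) * w x))" using i' by simp
      fix x
      have "(\<Sum>b<B. (min (f n x) (real (Suc b)))\<^sup>2 * w x / (real (Suc b))\<^sup>2)
          = (\<Sum>b<B. (min (f n x) (real (Suc b)))\<^sup>2 / (real (Suc b))\<^sup>2) * w x"
        by (simp add: sum_distrib_right)
      also have "\<dots> \<le> 3 * min (f n x) (real B) * w x"
        using sum_truncated_squares_le[OF f] w by (intro mult_right_mono) auto
      finally show "(\<Sum>b<B. (min (f n x) (real (Suc b)))\<^sup>2 * w x / (real (Suc b))\<^sup>2)
          \<le> 3 * (min (f n x) (real B) * w x)" by simp
    qed
    finally show ?thesis by simp
  qed
  show ?thesis
    by (rule LIMSEQ_le[OF lim1 tendsto_mult_left[OF m]]) (use le in blast)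
qed

text \<open>
  The weight \<^term>\<open>w\<close> below is chosen such that \<open>w * h b\<close> and \<open>w * (h b)\<^sup>2\<close> are at most 1 for every
  level b and such that it is positive exactly where the limit \<^term>\<open>F\<close> is finite. With this
  weight the levels \<open>k + 1\<close> may be used; with the constant weight 1, which does not vanish where
  \<^term>\<open>F\<close> is infinite, only bounded levels.
\<close>

lemma hereditary_cesaro_nonneg:
  fixes f :: "nat \<Rightarrow> 'a \<Rightarrow> real"
  assumes f_meas[measurable]: "\<And>n. f n \<in> borel_measurable M" and f0: "\<And>n x. 0 \<le> f n x"
  shows "\<exists>(F :: 'a \<Rightarrow> ereal) s. F \<in> borel_measurable M \<and> (\<forall>x. 0 \<le> F x) \<and> strict_mono s \<and>
    hereditarily_cesaro_convergent M (\<lambda>k. f (s k)) F"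
proof -
  have min_meas[measurable]: "(\<lambda>x. min (f n x) c) \<in> borel_measurable M" for n c by measurable
  have "min (f n x) (real b) \<in> {0..real b}" for b n x using f0[of n x] by auto
  then obtain s0 and h :: "nat \<Rightarrow> 'a \<Rightarrow> real" where s0: "strict_mono s0" and h_meas[measurable]: "\<And>b. h b \<in> borel_measurable M"
    and h: "\<And>b x. h b x \<in> {0..real b}"
    and h_lim: "\<And>b. weakly_tendsto M (\<lambda>n x. min (f (s0 n) x) (real b)) (h b)"
    using countable_weak_compactness[of "\<lambda>b n x. min (f n x) (real b)" "\<lambda>_. 0" real] min_meas by auto
  \<comment> \<open>weak convergence of the squares makes the second moments converge for the weight defined below,
    which depends on the limits \<open>h b\<close>\<close>
  have "(min (f (s0 n) x) (real b))\<^sup>2 \<in> {0..(real b)\<^sup>2}" for b n x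
    using f0[of "s0 n" x] by (auto intro: power_mono)
  then obtain s1 and q :: "nat \<Rightarrow> 'a \<Rightarrow> real" where s1: "strict_mono s1"
    and q_lim: "\<And>b. weakly_tendsto M (\<lambda>n x. (min (f (s0 (s1 n)) x) (real b))\<^sup>2) (q b)"
    using countable_weak_compactness[of "\<lambda>b n x. (min (f (s0 n) x) (real b))\<^sup>2" "\<lambda>_. 0" "\<lambda>b. (real b)\<^sup>2"]
      min_meas by auto
  define f1 where "f1 = (\<lambda>n. f (s0 (s1 n)))"
  have f1_meas[measurable]: "f1 n \<in> borel_measurable M" for n by (simp add: f1_def)
  have f1: "0 \<le> f1 n x" for n x using f0 by (simp add: f1_def)
  have h_lim1: "weakly_tendsto M (\<lambda>n x. min (f1 n x) b) (h b)" for b :: nat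
    using weakly_tendsto_subseq[OF h_lim s1] by (simp add: f1_def)
  have q_lim1: "weakly_tendsto M (\<lambda>n x. (min (f1 n x) b)\<^sup>2) (q b)" for b :: nat
    using q_lim by (simp add: f1_def)
  define F :: "'a \<Rightarrow> ereal" where "F = (\<lambda>x. SUP b. ereal (h b x))"
  have F_meas[measurable]: "F \<in> borel_measurable M" unfolding F_def by measurable
  have hF: "ereal (h b x) \<le> F x" for b x unfolding F_def by (rule SUP_upper) simp
  have F0: "0 \<le> F x" for x using order_trans[OF _ hF[of 0 x]] h[of 0 x] by simp
  define w where "w = (\<lambda>x. if F x = \<infinity> then 0 else 1 / (1 + real_of_ereal (F x))\<^sup>2)"
  have w_meas[measurable]: "w \<in> borel_measurable M" unfolding w_def by measurable
  have RF0: "0 \<le> real_of_ereal (F x)" for x using F0 by (simp add: real_of_ereal_pos)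
  have w_pos: "0 < w x \<longleftrightarrow> F x \<noteq> \<infinity>" for x
    using RF0[of x] by (auto simp: w_def intro!: zero_less_power)
  have w01: "w x \<in> {0..1}" for x
    using RF0[of x] by (auto simp: w_def divide_le_eq_1 intro!: one_le_power)
  have wb: "\<bar>w x\<bar> \<le> 1" for x using w01[of x] by auto
  have h0: "0 \<le> h b x" for b x using h[of b x] by simp
  have hR: "h b x \<le> real_of_ereal (F x)" if "F x \<noteq> \<infinity>" for b x
    using hF[of b x] F0[of x] that by (cases "F x") auto
  have wh2: "w x * (h b x)\<^sup>2 \<le> 1" for b x
  proof (cases "F x = \<infinity>")
    case False
    have "(h b x)\<^sup>2 \<le> (1 + real_of_ereal (F x))\<^sup>2"
      using hR[OF False, of b] h0[of b x] by (intro power_mono) auto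
    then show ?thesis using False RF0[of x] by (simp add: w_def divide_le_eq_1 add_nonneg_pos)
  qed (simp add: w_def)
  have wh: "w x * h b x \<le> 1" for b x
  proof (cases "F x = \<infinity>")
    case False
    have "1 + real_of_ereal (F x) \<le> (1 + real_of_ereal (F x))\<^sup>2"
      using RF0[of x] by (intro self_le_power) auto
    then have "h b x \<le> (1 + real_of_ereal (F x))\<^sup>2" using hR[OF False, of b] by linarith
    then show ?thesis using False RF0[of x] by (simp add: w_def divide_le_eq_1 add_nonneg_pos)
  qed (simp add: w_def)
  define v where "v = (\<lambda>b. \<integral>x. q b x * w x \<partial>M)"
  have v_lim: "(\<lambda>n. \<integral>x. (min (f1 n x) (real b))\<^sup>2 * w x \<partial>M) \<longlonglongrightarrow> v b" for b
    unfolding v_def by (rule weakly_tendstoD[OF q_lim1 w_meas wb])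
  have minb: "\<bar>min (f1 n x) (real b)\<bar> \<le> b" for n b x using f1[of n x] by auto
  have sqb: "\<bar>(min (f1 n x) (real b))\<^sup>2\<bar> \<le> (real b)\<^sup>2" for n b x
    using power_mono[OF minb[of n x b] abs_ge_zero, of 2] by simp
  have v0: "0 \<le> v b" for b
    by (rule LIMSEQ_le_const[OF v_lim]) (use w01 in \<open>auto intro!: integral_nonneg_AE\<close>)
  have v_sum: "(\<Sum>b<B. v (Suc b) / (real (Suc b))\<^sup>2) \<le> 3" for B
  proof -
    have "(\<Sum>b<B. v (Suc b) / (real (Suc b))\<^sup>2) \<le> 3 * (\<integral>x. h B x * w x \<partial>M)"
      by (rule truncated_second_moments_sum_le[OF f1_meas w_meas f1 w01 v_lim
        weakly_tendstoD[OF h_lim1 w_meas wb]])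
    also have "(\<integral>x. h B x * w x \<partial>M) \<le> 1"
    proof -
      have "\<bar>h B x * w x\<bar> \<le> 1" for x using wh[of x B] h0[of B x] w01[of x] by (simp add: mult.commute)
      then have "\<bar>\<integral>x. h B x * w x \<partial>M\<bar> \<le> 1" by (intro abs_integral_le_bound) auto
      then show ?thesis by simp
    qed
    finally show ?thesis by simp
  qed
  have v_summable: "summable (\<lambda>k. v (Suc k) / (real (Suc k))\<^sup>2)"
    using v_sum v0 by (intro bounded_imp_summable[of _ 3])
      (auto simp del: sum.lessThan_Suc simp flip: lessThan_Suc_atMost)

  \<comment> \<open>\<open>Q W k j n\<close>: the truncations of the j-th and n-th function, centred, are \<open>W\<close>-orthogonal up to
    the k-th error; \<open>k + 1\<close> is the highest level at which the k-th selected term is truncated\<close>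
  define Q where "Q = (\<lambda>W k j n. \<forall>a\<in>{..Suc k}. \<forall>b\<in>{..Suc k}.
    (\<integral>x. W x * ((min (f1 j x) (real a) - h a x) * (min (f1 n x) (real b) - h b x)) \<partial>M) \<le> (1/2) ^ k)"
  have Q_ev: "eventually (Q W k j) sequentially"
    if [measurable]: "W \<in> borel_measurable M" and W: "\<And>x. \<bar>W x\<bar> \<le> 1" for W k j
    unfolding Q_def
  proof (intro eventually_ball_finite ballI finite_atMost)
    fix a b
    let ?y = "\<lambda>x. W x * (min (f1 j x) (real a) - h a x)"
    have y: "\<bar>?y x\<bar> \<le> 1 * real a" for x
      using f1[of j x] h[of a x] by (intro abs_mult_le_bounds W) (auto simp: abs_le_iff)
    have hb: "\<bar>h b x\<bar> \<le> b" for x using h[of b x] by auto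
    have "(\<lambda>n. \<integral>x. ?y x * (min (f1 n x) (real b) - h b x) \<partial>M) \<longlonglongrightarrow> 0"
      by (rule weakly_tendsto_difference[OF h_lim1 _ _ _ minb hb y]) measurable
    then have "(\<lambda>n. \<integral>x. W x * ((min (f1 j x) (real a) - h a x) * (min (f1 n x) (real b) - h b x)) \<partial>M) \<longlonglongrightarrow> 0"
      by (simp add: mult.assoc)
    then have "eventually (\<lambda>n. (\<integral>x. W x * ((min (f1 j x) (real a) - h a x) * (min (f1 n x) (real b) - h b x)) \<partial>M) < (1/2) ^ k) sequentially"
      by (rule order_tendstoD(2)) simp
    then show "eventually (\<lambda>n. (\<integral>x. W x * ((min (f1 j x) (real a) - h a x) * (min (f1 n x) (real b) - h b x)) \<partial>M) \<le> (1/2) ^ k) sequentially"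
      by eventually_elim simp
  qed
  have "\<exists>s2. strict_mono s2
      \<and> (\<forall>k. \<forall>b\<in>{..Suc k}. (\<integral>x. (min (f1 (s2 k) x) (real b))\<^sup>2 * w x \<partial>M) \<le> v b + 1)
      \<and> (\<forall>k. \<forall>j<k. Q (\<lambda>_. 1) k (s2 j) (s2 k) \<and> Q w k (s2 j) (s2 k))"
  proof (rule fast_subsequence)
    show "eventually (\<lambda>n. Q (\<lambda>_. 1) k j n \<and> Q w k j n) sequentially" for k j
      using Q_ev[of "\<lambda>_. 1" k j] Q_ev[of w k j] wb by (auto intro: eventually_conj)
    show "eventually (\<lambda>n. \<forall>b\<in>{..Suc k}. (\<integral>x. (min (f1 n x) (real b))\<^sup>2 * w x \<partial>M) \<le> v b + 1) sequentially" for k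
    proof (intro eventually_ball_finite ballI finite_atMost)
      fix b
      have "eventually (\<lambda>n. (\<integral>x. (min (f1 n x) (real b))\<^sup>2 * w x \<partial>M) < v b + 1) sequentially"
        by (rule order_tendstoD(2)[OF v_lim]) simp
      then show "eventually (\<lambda>n. (\<integral>x. (min (f1 n x) (real b))\<^sup>2 * w x \<partial>M) \<le> v b + 1) sequentially"
        by eventually_elim simp
    qed
  qed
  then obtain s2 where s2: "strict_mono s2"
    and sq: "\<And>k b. b \<le> Suc k \<Longrightarrow> (\<integral>x. (min (f1 (s2 k) x) (real b))\<^sup>2 * w x \<partial>M) \<le> v b + 1"
    and Q: "\<And>k j. j < k \<Longrightarrow> Q (\<lambda>_. 1) k (s2 j) (s2 k)" "\<And>k j. j < k \<Longrightarrow> Q w k (s2 j) (s2 k)"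
    by (auto simp: Ball_def)
  define g where "g = (\<lambda>k. f1 (s2 k))"
  have g_meas[measurable]: "g n \<in> borel_measurable M" for n by (simp add: g_def)
  have g0: "0 \<le> g n x" for n x by (simp add: g_def f1)
  have cross: "(\<integral>x. W x * ((min (g j x) (real a) - h a x) * (min (g k x) (real b) - h b x)) \<partial>M) \<le> (1/2) ^ k"
    if "j < k" "a \<le> Suc k" "b \<le> Suc k" "W = w \<or> W = (\<lambda>_. 1)" for j k a b W
    using that Q[of j k] unfolding Q_def g_def by auto

  have h_mono: "AE x in M. \<forall>b. h b x \<le> h (Suc b) x"
    unfolding AE_all_countable
  proof
    fix b
    show "AE x in M. h b x \<le> h (Suc b) x"
    proof (rule weak_limit_mono[OF h_lim1[of b] h_lim1[of "Suc b"], where C = "real (Suc b)"])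
      show "\<bar>h b x\<bar> \<le> real (Suc b)" "\<bar>h (Suc b) x\<bar> \<le> real (Suc b)"
        "\<bar>min (f1 n x) (real b)\<bar> \<le> real (Suc b)" for n x
        using h[of b x] h[of "Suc b" x] f1[of n x] by auto
    qed (use minb in \<open>auto simp del: of_nat_Suc\<close>)
  qed
  have h_lim_F: "AE x in M. F x \<noteq> \<infinity> \<longrightarrow> (\<lambda>k. h (Suc k) x) \<longlonglongrightarrow> real_of_ereal (F x)"
    using h_mono
  proof eventually_elim
    case (elim x)
    show ?case
    proof
      assume fin: "F x \<noteq> \<infinity>"
      have "incseq (\<lambda>b. ereal (h b x))" using elim by (intro incseq_SucI) simp
      then have "(\<lambda>b. ereal (h b x)) \<longlonglongrightarrow> F x" unfolding F_def by (rule LIMSEQ_SUP)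
      moreover have "F x = ereal (real_of_ereal (F x))" using fin F0[of x] by (cases "F x") auto
      ultimately have "(\<lambda>b. ereal (h b x)) \<longlonglongrightarrow> ereal (real_of_ereal (F x))" by simp
      then have "(\<lambda>b. h b x) \<longlonglongrightarrow> real_of_ereal (F x)" by (simp only: lim_ereal)
      then show "(\<lambda>k. h (Suc k) x) \<longlonglongrightarrow> real_of_ereal (F x)" by (rule LIMSEQ_Suc)
    qed
  qed

  have "AE x in M. (\<lambda>K. ereal ((1 / real K) * (\<Sum>k<K. g (r k) x))) \<longlonglongrightarrow> F x"
    if r: "strict_mono r" for r
  proof -
    have r_le: "k \<le> r k" for k by (rule seq_suble[OF r])
    have sq_r: "(\<integral>x. w x * (min (g (r k) x) (real (Suc k)))\<^sup>2 \<partial>M) \<le> v (Suc k) + 1" for k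
      using sq[of "Suc k" "r k"] r_le[of k] by (simp add: g_def mult.commute)
    have gsqb: "\<bar>(min (g n x) (real b))\<^sup>2\<bar> \<le> (real b)\<^sup>2" for n b x using sqb by (simp add: g_def)
    have i_sq: "integrable M (\<lambda>x. w x * (min (g n x) (real b))\<^sup>2)" for n b
      by (rule integrable_bounded[OF _ abs_mult_le_bounds[OF wb gsqb]]) measurable

    \<comment> \<open>growing truncation levels settle the set where the limit is finite\<close>
    have fin: "AE x in M. 0 < w x \<longrightarrow>
        (\<lambda>n. (\<Sum>k<n. min (g (r k) x) (real (Suc k))) / real n) \<longlonglongrightarrow> real_of_ereal (F x)"
    proof (rule truncated_cesaro_AE[where h = h and a = "\<lambda>k. v (Suc k) + 2" and t = Suc])
      show "(\<integral>x. w x * ((min (g j x) a - h a x) * (min (g k x) b - h b x)) \<partial>M) \<le> (1/2) ^ k"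
        if "j < k" "a \<le> Suc k" "b \<le> Suc k" for j k a b
        using cross[OF that] by blast
      show "AE x in M. 0 < w x \<longrightarrow> (\<lambda>k. h (Suc k) x) \<longlonglongrightarrow> real_of_ereal (F x)"
        using h_lim_F by (simp add: w_pos)
      show "summable (\<lambda>k. (v (Suc k) + 2) / (real (Suc k))\<^sup>2)"
        using summable_add[OF v_summable summable_inverse_squares[of 2]] by (simp add: add_divide_distrib)
      show "0 \<le> v (Suc k) + 2" for k using v0[of "Suc k"] by simp
      fix k
      have "(\<integral>x. w x * (min (g (r k) x) (real (Suc k)) - h (Suc k) x)\<^sup>2 \<partial>M)
          \<le> (\<integral>x. w x * (min (g (r k) x) (real (Suc k)))\<^sup>2 + 1 \<partial>M)"
      proof (rule integral_mono)
        show "integrable M (\<lambda>x. w x * (min (g (r k) x) (real (Suc k)))\<^sup>2 + 1)"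
          by (intro Bochner_Integration.integrable_add i_sq) simp
        have d: "\<bar>min (g (r k) x) (real (Suc k)) - h (Suc k) x\<bar> \<le> real (Suc k)" for x
          using g0[of "r k" x] h[of "Suc k" x] by (auto simp: abs_le_iff)
        have "\<bar>w x * (min (g (r k) x) (real (Suc k)) - h (Suc k) x)\<^sup>2\<bar> \<le> 1 * (real (Suc k) * real (Suc k))" for x
          unfolding power2_eq_square by (intro abs_mult_le_bounds wb d)
        then show "integrable M (\<lambda>x. w x * (min (g (r k) x) (real (Suc k)) - h (Suc k) x)\<^sup>2)"
          by (rule integrable_bounded[rotated]) measurable
        fix x
        let ?m = "min (g (r k) x) (real (Suc k))"
        have "0 \<le> ?m * h (Suc k) x" using g0[of "r k" x] h0[of "Suc k" x] by simp
        then have "(?m - h (Suc k) x)\<^sup>2 \<le> ?m\<^sup>2 + (h (Suc k) x)\<^sup>2"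
          by (simp add: power2_diff mult.commute)
        then have "w x * (?m - h (Suc k) x)\<^sup>2 \<le> w x * (?m\<^sup>2 + (h (Suc k) x)\<^sup>2)"
          using w01[of x] by (intro mult_left_mono) auto
        then show "w x * (?m - h (Suc k) x)\<^sup>2 \<le> w x * ?m\<^sup>2 + 1"
          using wh2[of x "Suc k"] by (simp add: distrib_left)
      qed
      also have "\<dots> = (\<integral>x. w x * (min (g (r k) x) (real (Suc k)))\<^sup>2 \<partial>M) + 1"
        by (subst Bochner_Integration.integral_add[OF i_sq]) (simp_all add: prob_space)
      finally show "(\<integral>x. w x * (min (g (r k) x) (real (Suc k)) - h (Suc k) x)\<^sup>2 \<partial>M) \<le> v (Suc k) + 2"
        using sq_r[of k] by linarith
    qed (use r g0 h w01 RF0 in auto)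

    \<comment> \<open>bounded truncation levels give lower bounds everywhere\<close>
    have inf: "AE x in M. \<forall>N. (\<lambda>n. (\<Sum>k<n. min (g (r k) x) (real (min N (Suc k)))) / real n) \<longlonglongrightarrow> h N x"
      unfolding AE_all_countable
    proof
      fix N
      have "AE x in M. 0 < (1::real) \<longrightarrow>
        (\<lambda>n. (\<Sum>k<n. min (g (r k) x) (real (min N (Suc k)))) / real n) \<longlonglongrightarrow> h N x"
      proof (rule truncated_cesaro_AE[where h = h and w = "\<lambda>_. 1" and a = "\<lambda>k. real N * real N" and t = "\<lambda>k. min N (Suc k)"])
        show "(\<integral>x. 1 * ((min (g j x) a - h a x) * (min (g k x) b - h b x)) \<partial>M) \<le> (1/2) ^ k"
          if "j < k" "a \<le> Suc k" "b \<le> Suc k" for j k a b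
          using cross[OF that, of "\<lambda>_. 1"] by simp
        have "(\<lambda>k. h (min N (Suc k)) x) \<longlonglongrightarrow> h N x" for x
          by (rule tendsto_eventually) (auto simp: eventually_sequentially min_def intro!: exI[of _ N])
        then show "AE x in M. 0 < (1::real) \<longrightarrow> (\<lambda>k. h (min N (Suc k)) x) \<longlonglongrightarrow> h N x" by simp
        fix k
        have d: "\<bar>min (g (r k) x) (real (min N (Suc k))) - h (min N (Suc k)) x\<bar> \<le> real N" for x
          using g0[of "r k" x] h[of "min N (Suc k)" x] by (auto simp: abs_le_iff)
        have "\<bar>\<integral>x. (min (g (r k) x) (real (min N (Suc k))) - h (min N (Suc k)) x)
            * (min (g (r k) x) (real (min N (Suc k))) - h (min N (Suc k)) x) \<partial>M\<bar> \<le> real N * real N"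
          by (rule abs_integral_le_bound[OF _ abs_mult_le_bounds[OF d d]]) measurable
        then show "(\<integral>x. 1 * (min (g (r k) x) (real (min N (Suc k))) - h (min N (Suc k)) x)\<^sup>2 \<partial>M) \<le> real N * real N"
          by (simp add: power2_eq_square abs_le_iff)
      qed (use r g0 h h0 summable_inverse_squares in auto)
      then show "AE x in M. (\<lambda>n. (\<Sum>k<n. min (g (r k) x) (real (min N (Suc k)))) / real n) \<longlonglongrightarrow> h N x"
        by simp
    qed

    \<comment> \<open>where the truncation at \<open>k + 1\<close> is active the k-th term equals \<open>w x\<close>, so by convergence of the
      series it is inactive from some k on if \<open>w x\<close> is positive\<close>
    have "AE x in M. summable (\<lambda>k. w x * (min (g (r k) x) (real (Suc k)))\<^sup>2 / (real (Suc k))\<^sup>2)"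
    proof (rule AE_summable_if_integrals_bounded)
      show "integrable M (\<lambda>x. w x * (min (g (r k) x) (real (Suc k)))\<^sup>2 / (real (Suc k))\<^sup>2)" for k
        by (intro integrable_divide i_sq)
      show "0 \<le> w x * (min (g (r k) x) (real (Suc k)))\<^sup>2 / (real (Suc k))\<^sup>2" for k x
        using w01[of x] by simp
      have sm: "summable (\<lambda>k. (v (Suc k) + 1) / (real (Suc k))\<^sup>2)"
        using summable_add[OF v_summable summable_inverse_squares[of 1]] by (simp add: add_divide_distrib)
      fix I
      have "(\<Sum>k<I. \<integral>x. w x * (min (g (r k) x) (real (Suc k)))\<^sup>2 / (real (Suc k))\<^sup>2 \<partial>M)
          \<le> (\<Sum>k<I. (v (Suc k) + 1) / (real (Suc k))\<^sup>2)"
        unfolding integral_divide_zero by (intro sum_mono divide_right_mono sq_r) simp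
      also have "\<dots> \<le> (\<Sum>k. (v (Suc k) + 1) / (real (Suc k))\<^sup>2)"
        using v0 by (intro sum_le_suminf sm) (auto simp: add_nonneg_nonneg)
      finally show "(\<Sum>k<I. \<integral>x. w x * (min (g (r k) x) (real (Suc k)))\<^sup>2 / (real (Suc k))\<^sup>2 \<partial>M)
          \<le> (\<Sum>k. (v (Suc k) + 1) / (real (Suc k))\<^sup>2)" .
    qed
    with fin inf show ?thesis
    proof eventually_elim
      case (elim x)
      show ?case
      proof (cases "F x = \<infinity>")
        case True
        show ?thesis
          unfolding True tendsto_PInfty
        proof
          fix B
          have "ereal B < (SUP b. ereal (h b x))" using True by (simp add: F_def)
          then obtain N where N: "B < h N x" by (auto simp: less_SUP_iff)
          have "eventually (\<lambda>n. B < (\<Sum>k<n. min (g (r k) x) (real (min N (Suc k)))) / real n) sequentially"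
            using elim(2) N by (intro order_tendstoD(1)) auto
          then show "eventually (\<lambda>n. ereal B < ereal ((1 / real n) * (\<Sum>k<n. g (r k) x))) sequentially"
          proof eventually_elim
            case (elim n)
            have "(\<Sum>k<n. min (g (r k) x) (real (min N (Suc k)))) / real n \<le> (\<Sum>k<n. g (r k) x) / real n"
              by (intro divide_right_mono sum_mono) auto
            then show ?case using elim by simp
          qed
        qed
      next
        case False
        then have pos: "0 < w x" by (simp add: w_pos)
        have "(\<lambda>k. w x * (min (g (r k) x) (real (Suc k)))\<^sup>2 / (real (Suc k))\<^sup>2) \<longlonglongrightarrow> 0"
          using elim(3) by (rule summable_LIMSEQ_zero)
        then have "eventually (\<lambda>k. w x * (min (g (r k) x) (real (Suc k)))\<^sup>2 / (real (Suc k))\<^sup>2 < w x) sequentially"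
          using pos by (rule order_tendstoD(2))
        then have ev: "eventually (\<lambda>k. g (r k) x - min (g (r k) x) (real (Suc k)) = 0) sequentially"
        proof eventually_elim
          case (elim k)
          have "\<not> real (Suc k) \<le> g (r k) x"
          proof
            assume "real (Suc k) \<le> g (r k) x"
            then have "min (g (r k) x) (real (Suc k)) = real (Suc k)" by (rule min.absorb2)
            then show False using elim by (simp del: of_nat_Suc)
          qed
          then show ?case by simp
        qed
        have "(\<lambda>n. (\<Sum>k<n. g (r k) x - min (g (r k) x) (real (Suc k))) / real n) \<longlonglongrightarrow> 0"
          by (intro cesaro_mean_tendsto tendsto_eventually ev)
        from tendsto_add[OF this elim(1)[rule_format, OF pos]]
        have "(\<lambda>n. (\<Sum>k<n. g (r k) x) / real n) \<longlonglongrightarrow> real_of_ereal (F x)"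
          by (simp add: sum_subtractf add_divide_distrib[symmetric])
        then have "(\<lambda>n. ereal ((1 / real n) * (\<Sum>k<n. g (r k) x))) \<longlonglongrightarrow> ereal (real_of_ereal (F x))"
          by (simp add: lim_ereal)
        moreover have "ereal (real_of_ereal (F x)) = F x" using False F0[of x] by (cases "F x") auto
        ultimately show ?thesis by simp
      qed
    qed
  qed
  then have "hereditarily_cesaro_convergent M g F"
    unfolding hereditarily_cesaro_convergent_def by blast
  moreover have "g = (\<lambda>k. f ((s0 \<circ> s1 \<circ> s2) k))" by (simp add: g_def f1_def)
  moreover have "strict_mono (s0 \<circ> s1 \<circ> s2)" by (intro strict_mono_o s0 s1 s2)
  ultimately show ?thesis using F_meas F0 by metis
qed

end

theorem theorem3p1:
  fixes M :: "'a measure" and f :: "nat \<Rightarrow> 'a \<Rightarrow> real"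
  assumes "prob_space M"
    and "\<And>n. f n \<in> borel_measurable M"
    and "\<And>n \<omega>. \<omega> \<in> space M \<Longrightarrow> 0 \<le> f n \<omega>"
  shows "\<exists>(f_lim :: 'a \<Rightarrow> ereal) (s :: nat \<Rightarrow> nat).
           f_lim \<in> borel_measurable M \<and>
           (\<forall>\<omega>\<in>space M. 0 \<le> f_lim \<omega>) \<and>
           strict_mono s \<and>
           hereditarily_cesaro_convergent M (\<lambda>k. f (s k)) f_lim"
proof -
  interpret prob_space M by fact
  note assms(2)[measurable]
  \<comment> \<open>\<open>f n\<close> may be negative outside the space of \<open>M\<close>; its positive part is not\<close>
  have "(\<lambda>\<omega>. max 0 (f n \<omega>)) \<in> borel_measurable M" for n by measurable
  then obtain F s where F: "F \<in> borel_measurable M" "\<forall>\<omega>. 0 \<le> F \<omega>" and s: "strict_mono s"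
    and conv: "hereditarily_cesaro_convergent M (\<lambda>k \<omega>. max 0 (f (s k) \<omega>)) F"
    using hereditary_cesaro_nonneg[of "\<lambda>n \<omega>. max 0 (f n \<omega>)"] by auto
  have "hereditarily_cesaro_convergent M (\<lambda>k. f (s k)) F"
    unfolding hereditarily_cesaro_convergent_def
  proof (intro allI impI)
    fix r :: "nat \<Rightarrow> nat" assume "strict_mono r"
    then have "AE \<omega> in M. (\<lambda>K. ereal ((1 / real K) * (\<Sum>k<K. max 0 (f (s (r k)) \<omega>)))) \<longlonglongrightarrow> F \<omega>"
      using conv unfolding hereditarily_cesaro_convergent_def by blast
    then show "AE \<omega> in M. (\<lambda>K. ereal ((1 / real K) * (\<Sum>k<K. f (s (r k)) \<omega>))) \<longlonglongrightarrow> F \<omega>"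
      using AE_space by eventually_elim (simp add: max_absorb2 assms(3))
  qed
  then show ?thesis using F s by blast
qed

end
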